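(* Let $d$ and $k$ be positive integers. Let $\mathbf L=(L_1,\dots,L_d)\in\mathbb{Z}^d$ and $\mathbf N^{(j)}=(N^{(j)}_1,\dots,N^{(j)}_d)\in\mathbb{Z}^d$, $j=1,\dots,k$, satisfy $\mathbf 0\le \mathbf L\le \mathbf N^{(1)}$ and $\mathbf N^{(2)}\ge\mathbf 0,\dots,\mathbf N^{(k)}\ge \mathbf 0$. Define the formal power series in $\mathbf z=(z_1,\dots,z_d)$ $$F_{\mathbf N}(\mathbf z)=\sum_{\mathbf m\ge\mathbf 0}\mathbf z^{\mathbf m}\prod_{j=1}^{k}\frac{\big(\sum_{i=1}^d N^{(j)}_im_i\big)!}{\prod_{i=1}^{d}m_i!^{N_i^{(j)}}},\qquad G_{\mathbf L,\mathbf N}(\mathbf z)=\sum_{\mathbf m\ge\mathbf 0}\mathbf z^{\mathbf m}H_{\sum_{i=1}^d L_im_i}\prod_{j=1}^{k}\frac{\big(\sum_{i=1}^d N^{(j)}_im_i\big)!}{\prod_{i=1}^{d}m_i!^{N_i^{(j)}}}.$$ Then $$q_{\mathbf L,\mathbf N}(\mathbf z):=\exp\big(G_{\mathbf L,\mathbf N}(\mathbf z)/F_{\mathbf N}(\mathbf z)\big)\in\mathbb{Z}[[\mathbf z]].$$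
   Context: $H_m=\sum_{j=1}^m 1/j$ is the $m$-th harmonic number, with $H_0=0$. For $\mathbf m\in\mathbb{Z}_{\ge0}^d$, $\mathbf z^{\mathbf m}=z_1^{m_1}\cdots z_d^{m_d}$. Vector inequalities are componentwise, $\mathbf 0=(0,\dots,0)$. $\mathbb{Z}[[\mathbf z]]$ is the ring of formal power series in $z_1,\dots,z_d$ with integer coefficients; $F_{\mathbf N}(\mathbf z)$ has constant term $1$ and $G_{\mathbf L,\mathbf N}$ has zero constant term, so the exponential of their quotient is a well-defined formal power series with rational coefficients. *)

theory Defs
  imports "HOL-Analysis.Analysis"
begin

section \<open>Formal power series in finitely many variables\<close>

text \<open>
  The variables are indexed by the finite type \<open>'d\<close>, so that \<open>d = CARD('d) \<ge> 1\<close>, and a series is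
  its family of coefficients, indexed by the exponent vectors \<open>m :: nat ^ 'd\<close>.
\<close>

typedef (overloaded) ('a, 'd::finite) mfps = "UNIV :: (nat ^ 'd \<Rightarrow> 'a) set"
  morphisms mfps_coeff Abs_mfps
  by simp

setup_lifting type_definition_mfps

lemma mfps_coeff_Abs [simp]: "mfps_coeff (Abs_mfps f) m = f m"
  by (simp add: Abs_mfps_inverse)

lemma mfps_eqI: "(\<And>m. mfps_coeff F m = mfps_coeff G m) \<Longrightarrow> F = G"
  by (metis ext mfps_coeff_inject)

definition mdegree :: "nat ^ 'd \<Rightarrow> nat" where
  "mdegree m = (\<Sum>i\<in>UNIV. m $ i)"

lemma mdegree_0 [simp]: "mdegree 0 = 0"
  by (simp add: mdegree_def)

lemma mdegree_add [simp]: "mdegree (a + b) = mdegree a + mdegree b"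
  by (simp add: mdegree_def sum.distrib)

lemma mdegree_eq_0_iff [simp]: "mdegree m = 0 \<longleftrightarrow> m = 0"
  by (simp add: mdegree_def vec_eq_iff)

definition splits :: "nat ^ 'd \<Rightarrow> ((nat ^ 'd) \<times> (nat ^ 'd)) set" where
  "splits m = {(a, b). a + b = m}"

lemma finite_le_nat_vec: "finite {a :: nat ^ 'd. a \<le> m}"
proof -
  have "vec_nth ` {a. a \<le> m} \<subseteq> PiE UNIV (\<lambda>i. {..m $ i})"
    by (auto simp: less_eq_vec_def)
  moreover have "finite (PiE (UNIV :: 'd set) (\<lambda>i. {..m $ i}))"
    by (intro finite_PiE) auto
  ultimately have "finite (vec_nth ` {a. a \<le> m})"
    by (rule finite_subset)
  then show ?thesis
    by (rule finite_imageD) (simp add: inj_on_def vec_nth_inject)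
qed

lemma finite_splits [simp, intro]: "finite (splits m)"
proof -
  have "splits m \<subseteq> {a. a \<le> m} \<times> {a. a \<le> m}"
    by (auto simp: splits_def less_eq_vec_def)
  then show ?thesis
    by (rule finite_subset) (simp add: finite_le_nat_vec)
qed

lemma splits_0 [simp]: "splits 0 = {(0, 0)}"
  by (auto simp: splits_def vec_eq_iff)

instantiation mfps :: (comm_ring_1, finite) comm_ring_1
begin

lift_definition zero_mfps :: "('a, 'b) mfps" is "\<lambda>_. 0" .
lift_definition one_mfps :: "('a, 'b) mfps" is "\<lambda>m. if m = 0 then 1 else 0" .
lift_definition plus_mfps :: "('a, 'b) mfps \<Rightarrow> ('a, 'b) mfps \<Rightarrow> ('a, 'b) mfps"
  is "\<lambda>f g m. f m + g m" .
lift_definition minus_mfps :: "('a, 'b) mfps \<Rightarrow> ('a, 'b) mfps \<Rightarrow> ('a, 'b) mfps"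
  is "\<lambda>f g m. f m - g m" .
lift_definition uminus_mfps :: "('a, 'b) mfps \<Rightarrow> ('a, 'b) mfps" is "\<lambda>f m. - f m" .
lift_definition times_mfps :: "('a, 'b) mfps \<Rightarrow> ('a, 'b) mfps \<Rightarrow> ('a, 'b) mfps"
  is "\<lambda>f g m. \<Sum>(a, b)\<in>splits m. f a * g b" .

instance
proof
  fix F G H :: "('a, 'b) mfps"
  show "F + G + H = F + (G + H)" by transfer (simp add: add.assoc)
  show "F + G = G + F" by transfer (simp add: add.commute)
  show "0 + F = F" by transfer simp
  show "- F + F = 0" by transfer simp
  show "F - G = F + - G" by transfer simp
  show "(0 :: ('a, 'b) mfps) \<noteq> 1" by transfer (metis zero_neq_one)
  show "F * G = G * F"
    by transfer
      (rule ext, rule sum.reindex_bij_witness[of _ prod.swap prod.swap],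
        auto simp: splits_def add.commute mult.commute)
  show "(F + G) * H = F * H + G * H"
    by transfer (simp add: distrib_right sum.distrib case_prod_unfold)
  show "1 * F = F"
  proof transfer
    fix f :: "nat ^ 'b \<Rightarrow> 'a"
    have "(\<Sum>(a, b)\<in>splits m. (if a = 0 then 1 else 0) * f b) = f m" for m
    proof -
      have "(\<Sum>(a, b)\<in>splits m. (if a = 0 then 1 else 0) * f b) =
          (\<Sum>(a, b)\<in>{(0 :: nat ^ 'b, m)}. (if a = 0 then 1 else 0) * f b)"
        by (rule sum.mono_neutral_right[OF finite_splits]) (auto simp: splits_def split: if_splits)
      then show ?thesis by simp
    qed
    then show "(\<lambda>m. \<Sum>(a, b)\<in>splits m. (if a = 0 then 1 else 0) * f b) = f" by blast
  qed
  show "F * G * H = F * (G * H)"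
  proof transfer
    fix f g h :: "nat ^ 'b \<Rightarrow> 'a"
    show "(\<lambda>m. \<Sum>(a, b)\<in>splits m. (\<Sum>(a, b)\<in>splits a. f a * g b) * h b) =
      (\<lambda>m. \<Sum>(a, b)\<in>splits m. f a * (\<Sum>(a, b)\<in>splits b. g a * h b))"
    proof
      fix m :: "nat ^ 'b"
      have "(\<Sum>(a, b)\<in>splits m. (\<Sum>(a, b)\<in>splits a. f a * g b) * h b) =
          (\<Sum>(p, q)\<in>Sigma (splits m) (\<lambda>p. splits (fst p)). f (fst q) * g (snd q) * h (snd p))"
        by (subst sum.Sigma[symmetric]) (auto simp: sum_distrib_right case_prod_unfold)
      also have "\<dots> =
          (\<Sum>(p, q)\<in>Sigma (splits m) (\<lambda>p. splits (snd p)). f (fst p) * g (fst q) * h (snd q))"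
        by (rule sum.reindex_bij_witness
              [of _ "\<lambda>(p, q). ((fst p + fst q, snd q), (fst p, fst q))"
                    "\<lambda>(p, q). ((fst q, snd q + snd p), (snd q, snd p))"])
          (auto simp: splits_def add.assoc)
      also have "\<dots> = (\<Sum>(a, b)\<in>splits m. f a * (\<Sum>(a, b)\<in>splits b. g a * h b))"
        by (subst sum.Sigma[symmetric]) (auto simp: sum_distrib_left case_prod_unfold mult.assoc)
      finally show "(\<Sum>(a, b)\<in>splits m. (\<Sum>(a, b)\<in>splits a. f a * g b) * h b) =
          (\<Sum>(a, b)\<in>splits m. f a * (\<Sum>(a, b)\<in>splits b. g a * h b))" .
    qed
  qed
qed

end

lemma mfps_coeff_0 [simp]: "mfps_coeff 0 m = 0"
  by transfer simp

lemma mfps_coeff_1: "mfps_coeff 1 m = (if m = 0 then 1 else 0)"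
  by transfer simp

lemma mfps_coeff_add [simp]: "mfps_coeff (F + G) m = mfps_coeff F m + mfps_coeff G m"
  by transfer simp

lemma mfps_coeff_diff [simp]: "mfps_coeff (F - G) m = mfps_coeff F m - mfps_coeff G m"
  by transfer simp

lemma mfps_coeff_mult:
  "mfps_coeff (F * G) m = (\<Sum>(a, b)\<in>splits m. mfps_coeff F a * mfps_coeff G b)"
  by transfer simp

lemma mfps_coeff_sum: "mfps_coeff (\<Sum>n\<in>A. F n) m = (\<Sum>n\<in>A. mfps_coeff (F n) m)"
  by (induction A rule: infinite_finite_induct) auto

lemma mfps_coeff_power_eq_0:
  assumes "mfps_coeff F 0 = 0" and "mdegree m < n"
  shows "mfps_coeff (F ^ n) m = 0"
  using assms(2)
proof (induction n arbitrary: m)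
  case 0
  then show ?case by simp
next
  case (Suc n)
  have "mfps_coeff F a * mfps_coeff (F ^ n) b = 0" if "a + b = m" for a b
  proof (cases "a = 0")
    case True
    then show ?thesis using assms(1) by simp
  next
    case False
    then have "mdegree a > 0" using mdegree_eq_0_iff by blast
    moreover have "mdegree m = mdegree a + mdegree b" using that by auto
    ultimately have "mdegree b < n" using Suc.prems by linarith
    then show ?thesis using Suc.IH by simp
  qed
  then show ?case
    by (auto simp: mfps_coeff_mult splits_def intro!: sum.neutral)
qed

instantiation mfps :: (field, finite) inverse
begin

definition inverse_mfps_def:
  "inverse (F :: ('a, 'b) mfps) = (if F dvd 1 then (THE G. F * G = 1) else 0)"

definition divide_mfps_def:
  "(F :: ('a, 'b) mfps) div G = F * inverse G"

instance ..

end

lemma mfps_dvd_1: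
  fixes F :: "('a :: field, 'd::finite) mfps"
  assumes "mfps_coeff F 0 \<noteq> 0"
  shows "F dvd 1"
proof -
  define c where "c = mfps_coeff F 0"
  define C where "C = (Abs_mfps (\<lambda>m. if m = 0 then inverse c else 0) :: ('a, 'd) mfps)"
  define u where "u = 1 - C * F"
  define S where "S = Abs_mfps (\<lambda>m. \<Sum>n\<le>mdegree m. mfps_coeff (u ^ n) m)"
  have u0: "mfps_coeff u 0 = 0"
    using assms by (simp add: u_def mfps_coeff_1 mfps_coeff_mult C_def c_def)
  have S_eq: "mfps_coeff S b = mfps_coeff (\<Sum>n\<le>N. u ^ n) b" if "mdegree b \<le> N" for b N
  proof -
    have "(\<Sum>n\<le>N. mfps_coeff (u ^ n) b) = (\<Sum>n\<le>mdegree b. mfps_coeff (u ^ n) b)"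
      by (rule sum.mono_neutral_right) (use that in \<open>auto simp: mfps_coeff_power_eq_0[OF u0]\<close>)
    then show ?thesis by (simp add: S_def mfps_coeff_sum)
  qed
  have "(1 - u) * S = 1"
  proof (rule mfps_eqI)
    fix m :: "nat ^ 'd"
    define N where "N = mdegree m"
    have "mfps_coeff ((1 - u) * S) m = mfps_coeff ((1 - u) * (\<Sum>n\<le>N. u ^ n)) m"
      unfolding mfps_coeff_mult
      by (intro sum.cong) (auto simp: splits_def N_def simp del: mfps_coeff_diff intro!: S_eq)
    also have "(1 - u) * (\<Sum>n\<le>N. u ^ n) = 1 - u ^ Suc N"
      by (rule sum_gp_basic)
    also have "mfps_coeff \<dots> m = mfps_coeff 1 m"
      using mfps_coeff_power_eq_0[OF u0, of m "Suc N"] by (simp add: N_def del: power_Suc)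
    finally show "mfps_coeff ((1 - u) * S) m = mfps_coeff 1 m" .
  qed
  then have "1 = F * (C * S)" by (simp add: u_def mult_ac)
  then show ?thesis ..
qed

lemma mfps_mult_inverse:
  fixes F :: "('a :: field, 'd::finite) mfps"
  assumes "mfps_coeff F 0 \<noteq> 0"
  shows "F * inverse F = 1"
proof -
  have dvd: "F dvd 1" using assms by (rule mfps_dvd_1)
  then obtain G where G: "F * G = 1" unfolding dvd_def by auto
  moreover have "G' = G" if "F * G' = 1" for G'
  proof -
    have "G' = (F * G) * G'" using G by simp
    also have "\<dots> = (F * G') * G" by (simp only: mult_ac)
    finally show ?thesis using that by simp
  qed
  ultimately have "F * (THE G. F * G = 1) = 1"
    by (rule theI)
  then show ?thesis using dvd by (simp add: inverse_mfps_def)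
qed

text \<open>
  The exponential \<open>\<Sum>n. F\<^sup>n / n!\<close> of a series \<open>F\<close> with zero constant term. Since then the coefficient of
  \<open>z\<^sup>m\<close> in \<open>F\<^sup>n\<close> vanishes for \<open>n > mdegree m\<close> (\<open>mfps_coeff_power_eq_0\<close>), the sum below omits only zeros.
  For other \<open>F\<close> the value is meaningless.
\<close>

definition mfps_exp :: "('a :: field_char_0, 'd::finite) mfps \<Rightarrow> ('a, 'd) mfps" where
  "mfps_exp F = Abs_mfps (\<lambda>m. \<Sum>n\<le>mdegree m. mfps_coeff (F ^ n) m / fact n)"

definition mfps_Ints :: "('a :: ring_1, 'd::finite) mfps set" where
  "mfps_Ints = {F. \<forall>m. mfps_coeff F m \<in> \<int>}"

section \<open>The series \<open>F\<close> and \<open>G\<close>\<close>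

text \<open>The library function \<open>harm\<close> is not available with values in the rationals.\<close>

definition harmonic :: "nat \<Rightarrow> rat" where
  "harmonic n = (\<Sum>j=1..n. 1 / of_nat j)"

definition pairing :: "int ^ 'd \<Rightarrow> nat ^ 'd \<Rightarrow> int" where
  "pairing N m = (\<Sum>i\<in>UNIV. N $ i * int (m $ i))"

definition FG_coeff :: "nat \<Rightarrow> (nat \<Rightarrow> int ^ 'd) \<Rightarrow> nat ^ 'd \<Rightarrow> rat" where
  "FG_coeff k N m =
    (\<Prod>j=1..k. fact (nat (pairing (N j) m)) / (\<Prod>i\<in>UNIV. fact (m $ i) powi (N j $ i)))"

definition F_series :: "nat \<Rightarrow> (nat \<Rightarrow> int ^ 'd) \<Rightarrow> (rat, 'd::finite) mfps" where
  "F_series k N = Abs_mfps (\<lambda>m. FG_coeff k N m)"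

definition G_series :: "nat \<Rightarrow> int ^ 'd \<Rightarrow> (nat \<Rightarrow> int ^ 'd) \<Rightarrow> (rat, 'd::finite) mfps" where
  "G_series k L N = Abs_mfps (\<lambda>m. harmonic (nat (pairing L m)) * FG_coeff k N m)"

definition q_series :: "nat \<Rightarrow> int ^ 'd \<Rightarrow> (nat \<Rightarrow> int ^ 'd) \<Rightarrow> (rat, 'd::finite) mfps" where
  "q_series k L N = mfps_exp (G_series k L N / F_series k N)"

lemma F_series_constant: "mfps_coeff (F_series k N) 0 = 1"
  by (simp add: F_series_def FG_coeff_def pairing_def)

lemma G_series_constant: "mfps_coeff (G_series k L N) 0 = 0"
  by (simp add: G_series_def harmonic_def pairing_def)

lemma quotient_constant: "mfps_coeff (G_series k L N / F_series k N) 0 = 0"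
  by (simp add: divide_mfps_def mfps_coeff_mult G_series_constant)

end

theory Submission
  imports Defs "HOL-Number_Theory.Residues"
begin

text \<open>
  Integrality is checked at each prime \<open>p\<close> separately. By the Dieudonne--Dwork lemma,
  \<open>exp f\<close> with \<open>f = G / F\<close> is \<open>p\<close>-integral as soon as \<open>f(z\<^sup>p) - p f(z)\<close> is divisible by
  \<open>p\<close>, that is, \<open>F(z) G(z\<^sup>p) \<equiv> p F(z\<^sup>p) G(z)\<close> modulo \<open>p\<close>. Writing \<open>A\<close> for the coefficients of \<open>F\<close> and
  \<open>h m\<close> for the harmonic number of \<open>L \<cdot> m\<close>, the coefficient of \<open>z\<^bsup>a + pK\<^esup>\<close> in the difference is congruent to
  \<open>\<Sum>j \<le> K. h j * U j\<close> with \<open>U j = A (a + p (K - j)) * A j - A (K - j) * A (a + p j)\<close>.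
  Dwork's argument shows that the sum of \<open>U\<close> over the box \<open>p\<^sup>s m \<le> j < p\<^sup>s (m + 1)\<close> lies in
  \<open>p\<^bsup>s+1\<^esup> A m\<close>, while the variation of \<open>h\<close> between the corners of nested boxes has denominator
  dividing \<open>p\<^sup>s A m\<close>; summation by parts over the \<open>p\<close>-adic boxes concludes. The input is that
  \<open>A (v + p w) / A w\<close> is, as a function of \<open>w\<close>, \<open>p\<close>-integral and constant modulo \<open>p\<^bsup>s+1\<^esup>\<close> on residue
  classes modulo \<open>p\<^sup>s\<close>.
\<close>

section \<open>Rational numbers that are integral at a prime\<close>

text \<open>The localization of the integers at \<open>p\<close>, realised inside the rationals.
  Fractions need not be reduced, so closure under sums and products is immediate.\<close>

definition pint :: "nat \<Rightarrow> rat set" where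
  "pint p = {x. \<exists>a b :: int. \<not> int p dvd b \<and> x = of_int a / of_int b}"

text \<open>The principal fractional ideal of \<open>pint p\<close> generated by \<open>c\<close>;
  congruences are stated as membership of a difference. The generator is an arbitrary rational
  because the moduli below carry a factor \<open>A m\<close> besides a power of
  \<open>p\<close>.\<close>

definition pideal :: "nat \<Rightarrow> rat \<Rightarrow> rat set" where
  "pideal p c = {c * y | y. y \<in> pint p}"

text \<open>A prime factor of the reduced denominator would also divide the numerator, so the
  denominator is 1.\<close>

lemma Ints_if_all_pint:
  assumes "\<And>p. prime p \<Longrightarrow> x \<in> pint p"
  shows "x \<in> \<int>"
proof -
  obtain a b where ab: "quotient_of x = (a, b)"
    by fastforce
  have x: "x = of_int a / of_int b" and b: "b > 0" and cop: "coprime a b"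
    using quotient_of_div[OF ab] quotient_of_denom_pos[OF ab] quotient_of_coprime[OF ab] by auto
  have "b = 1"
  proof (rule ccontr)
    assume "b \<noteq> 1"
    with b have "nat b \<noteq> 1" by simp
    then obtain p where p: "prime p" "p dvd nat b"
      using prime_factor_nat by blast
    then have pb: "int p dvd b" using b by (simp add: int_dvd_int_iff[symmetric] del: int_dvd_int_iff)
    from assms[OF p(1)] obtain c d where cd: "\<not> int p dvd d" "x = of_int c / of_int d"
      by (auto simp: pint_def)
    then have "d \<noteq> 0" by auto
    with x b cd have "rat_of_int (a * d) = of_int (c * b)"
      by (simp add: field_simps)
    then have "a * d = c * b" by linarith
    with pb have "int p dvd a * d" by simp
    with p(1) cd(1) have "int p dvd a"
      by (simp add: prime_dvd_mult_iff)
    with pb cop p(1) show False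
      by (metis coprime_common_divisor not_prime_unit prime_int_nat_transfer nat_int prime_nat_int_transfer)
  qed
  then show ?thesis using x by simp
qed

locale prime_localization =
  fixes p :: nat
  assumes prime_p: "prime p"
begin

lemma of_nat_p_neq_0: "rat_of_nat p \<noteq> 0"
  using prime_gt_0_nat[OF prime_p] by simp

lemma pint_of_int [simp, intro]: "of_int a \<in> pint p"
proof -
  have "\<not> int p dvd 1" using prime_p by auto
  then show ?thesis unfolding pint_def by (intro CollectI exI[of _ a] exI[of _ 1]) simp
qed

lemma pint_of_nat [simp, intro]: "of_nat n \<in> pint p"
  using pint_of_int[of "int n"] by simp

lemma pint_0 [simp, intro]: "0 \<in> pint p" and pint_1 [simp, intro]: "1 \<in> pint p"
  using pint_of_int[of 0] pint_of_int[of 1] by simp_all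

lemma pint_Ints: "x \<in> \<int> \<Longrightarrow> x \<in> pint p"
  by (auto elim: Ints_cases)

lemma pint_mult [intro]:
  assumes "x \<in> pint p" "y \<in> pint p"
  shows "x * y \<in> pint p"
proof -
  obtain a b c d where "\<not> int p dvd b" "x = of_int a / of_int b"
    "\<not> int p dvd d" "y = of_int c / of_int d"
    using assms by (auto simp: pint_def)
  then have "\<not> int p dvd b * d" "x * y = of_int (a * c) / of_int (b * d)"
    using prime_p by (auto simp: prime_dvd_mult_iff)
  then show ?thesis unfolding pint_def by blast
qed

lemma pint_add [intro]:
  assumes "x \<in> pint p" "y \<in> pint p"
  shows "x + y \<in> pint p"
proof -
  obtain a b c d where *: "\<not> int p dvd b" "x = of_int a / of_int b"
    "\<not> int p dvd d" "y = of_int c / of_int d"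
    using assms by (auto simp: pint_def)
  then have "b \<noteq> 0" "d \<noteq> 0" by auto
  with * have "\<not> int p dvd b * d" "x + y = of_int (a * d + c * b) / of_int (b * d)"
    using prime_p by (auto simp: prime_dvd_mult_iff field_simps)
  then show ?thesis unfolding pint_def by blast
qed

lemma pint_sum [intro]: "(\<And>i. i \<in> S \<Longrightarrow> f i \<in> pint p) \<Longrightarrow> sum f S \<in> pint p"
  by (induction S rule: infinite_finite_induct) auto

lemma pint_prod [intro]: "(\<And>i. i \<in> S \<Longrightarrow> f i \<in> pint p) \<Longrightarrow> prod f S \<in> pint p"
  by (induction S rule: infinite_finite_induct) auto

lemma pint_power [intro]: "x \<in> pint p \<Longrightarrow> x ^ n \<in> pint p"
  by (induction n) auto

lemma pint_inverse_of_nat: "\<not> p dvd n \<Longrightarrow> inverse (of_nat n) \<in> pint p"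
  unfolding pint_def by (intro CollectI exI[of _ 1] exI[of _ "int n"]) (simp add: inverse_eq_divide)

lemma pideal_1 [simp]: "pideal p 1 = pint p"
  by (auto simp: pideal_def)

lemma pidealI: "y \<in> pint p \<Longrightarrow> c * y \<in> pideal p c"
  by (auto simp: pideal_def)

lemma pideal_0 [simp, intro]: "0 \<in> pideal p c"
  using pidealI[OF pint_0, of c] by simp

lemma pideal_add [intro]: "x \<in> pideal p c \<Longrightarrow> y \<in> pideal p c \<Longrightarrow> x + y \<in> pideal p c"
  by (auto simp: pideal_def simp flip: distrib_left)

lemma pideal_mult: "x \<in> pideal p c \<Longrightarrow> y \<in> pideal p d \<Longrightarrow> x * y \<in> pideal p (c * d)"
  unfolding pideal_def by (auto simp: mult_ac intro: pint_mult)

lemma pideal_mult_left: "x \<in> pint p \<Longrightarrow> y \<in> pideal p c \<Longrightarrow> x * y \<in> pideal p c"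
  using pideal_mult[of x 1 y c] by simp

lemma pideal_mult_right: "x \<in> pideal p c \<Longrightarrow> y \<in> pint p \<Longrightarrow> x * y \<in> pideal p c"
  using pideal_mult[of x c y 1] by simp

lemma pideal_uminus [intro]: "x \<in> pideal p c \<Longrightarrow> - x \<in> pideal p c"
  using pideal_mult_left[OF pint_of_int[of "-1"]] by simp

lemma pideal_diff [intro]: "x \<in> pideal p c \<Longrightarrow> y \<in> pideal p c \<Longrightarrow> x - y \<in> pideal p c"
  using pideal_add[of x c "- y"] by auto

lemma pideal_sum [intro]: "(\<And>i. i \<in> S \<Longrightarrow> f i \<in> pideal p c) \<Longrightarrow> sum f S \<in> pideal p c"
  by (induction S rule: infinite_finite_induct) auto

lemma pideal_subset:
  assumes "x \<in> pideal p (c * d)" "d \<in> pint p"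
  shows "x \<in> pideal p c"
  using assms by (auto simp: pideal_def mult.assoc)

lemma pideal_mult_cong:
  assumes "x - x' \<in> pideal p c" "y - y' \<in> pideal p c" "x' \<in> pint p" "y \<in> pint p"
  shows "x * y - x' * y' \<in> pideal p c"
proof -
  have "x * y - x' * y' = (x - x') * y + x' * (y - y')" by (simp add: algebra_simps)
  then show ?thesis using assms by (metis pideal_add pideal_mult_left pideal_mult_right)
qed

lemma pideal_prod_cong:
  assumes "\<And>i. i \<in> S \<Longrightarrow> f i - g i \<in> pideal p c"
    and "\<And>i. i \<in> S \<Longrightarrow> f i \<in> pint p" "\<And>i. i \<in> S \<Longrightarrow> g i \<in> pint p"
  shows "prod f S - prod g S \<in> pideal p c"
  using assms
  by (induction S rule: infinite_finite_induct) (auto intro!: pideal_mult_cong pint_prod)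

lemma pideal_inverse_cong:
  assumes "x - y \<in> pideal p c" "inverse x \<in> pint p" "inverse y \<in> pint p" "x \<noteq> 0" "y \<noteq> 0"
  shows "inverse x - inverse y \<in> pideal p c"
proof -
  have "inverse x - inverse y = - (inverse x * inverse y * (x - y))"
    using assms by (simp add: field_simps)
  then show ?thesis using assms by (auto intro!: pideal_uminus pideal_mult_left)
qed

lemma pideal_of_nat_cong: "[a = b] (mod q) \<Longrightarrow> of_nat a - of_nat b \<in> pideal p (of_nat q)"
proof -
  assume "[a = b] (mod q)"
  then have "[int a = int b] (mod int q)" by (simp add: cong_int_iff)
  then obtain k where "int a = int b + int q * k" by (metis cong_iff_lin cong_sym)
  then have "rat_of_int (int a) = of_int (int b + int q * k)" by presburger
  then have "rat_of_nat a - of_nat b = of_nat q * of_int k" by simp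
  then show ?thesis by (simp add: pidealI)
qed

lemma fermat_int: "int p dvd a ^ p - a"
proof -
  define n where "n = nat (a mod int p)"
  have p0: "int p > 0" using prime_gt_0_nat[OF prime_p] by simp
  have n: "[a = int n] (mod int p)"
    using p0 by (simp add: n_def cong_def)
  have "[n ^ p = n] (mod p)"
  proof (cases "p dvd n")
    case True
    then show ?thesis
      using prime_gt_0_nat[OF prime_p] by (metis cong_0_iff cong_sym cong_trans dvd_power dvd_trans)
  next
    case False
    then have "[n * n ^ (p - 1) = n * 1] (mod p)"
      using prime_p by (intro cong_mult cong_refl fermat_theorem)
    then show ?thesis using prime_gt_0_nat[OF prime_p] by (simp flip: power_Suc)
  qed
  then have "[int n ^ p = int n] (mod int p)" by (simp add: cong_int_iff flip: of_nat_power)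
  then have "[a ^ p = a] (mod int p)"
    using n by (meson cong_pow cong_sym cong_trans)
  then show ?thesis by (simp add: cong_iff_dvd_diff)
qed

text \<open>Fermat applies to numerator and denominator separately: with
  \<open>a ^ p = a + p * c\<close> and \<open>b ^ p = b + p * d\<close> the products
  \<open>a * b\<close> cancel in \<open>a ^ p * b - a * b ^ p\<close>, leaving a multiple of
  \<open>p\<close>.\<close>

lemma fermat_pint:
  assumes "x \<in> pint p"
  shows "x ^ p - x \<in> pideal p (of_nat p)"
proof -
  obtain a b where ab: "\<not> int p dvd b" "x = of_int a / of_int b"
    using assms by (auto simp: pint_def)
  then have b0: "b \<noteq> 0" by auto
  obtain c d where c: "a ^ p - a = int p * c" and d: "b ^ p - b = int p * d"
    using fermat_int unfolding dvd_def by metis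
  have "a ^ p = a + int p * c" "b ^ p = b + int p * d" using c d by auto
  then have e: "rat_of_int a ^ p = of_int a + of_nat p * of_int c"
    "rat_of_int b ^ p = of_int b + of_nat p * of_int d"
    by (simp_all flip: of_int_power)
  have bp: "rat_of_int b ^ p \<noteq> 0" using b0 by simp
  have "x ^ p - x = (of_int a ^ p * of_int b - of_int a * of_int b ^ p) / (of_int b ^ p * of_int b)"
    using bp b0 by (simp add: ab power_divide field_simps)
  also have "\<dots> = of_nat p * (of_int (c * b - a * d) / of_int (b ^ p * b))"
    by (simp add: e(1)) (simp add: e(2) algebra_simps)
  finally have "x ^ p - x = of_nat p * (of_int (c * b - a * d) / of_int (b ^ p * b))" .
  moreover have "\<not> int p dvd b ^ p * b"
    using ab(1) prime_p prime_dvd_power by (metis prime_dvd_mult_iff prime_nat_int_transfer)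
  then have "of_int (c * b - a * d) / of_int (b ^ p * b) \<in> pint p"
    unfolding pint_def by blast
  ultimately show ?thesis using pidealI by metis
qed

end

section \<open>Multinomial coefficients\<close>

definition dotn :: "nat ^ 'd \<Rightarrow> nat ^ 'd \<Rightarrow> nat" where
  "dotn l m = (\<Sum>i\<in>UNIV. l $ i * m $ i)"

lemma dotn_0_right [simp]: "dotn l 0 = 0"
  by (simp add: dotn_def)

lemma dotn_add_left: "dotn (l + l') m = dotn l m + dotn l' m"
  by (simp add: dotn_def algebra_simps sum.distrib)

lemma dotn_add_right: "dotn l (m + m') = dotn l m + dotn l m'"
  by (simp add: dotn_def algebra_simps sum.distrib)

lemma dotn_smult_right: "dotn l (c *s m) = c * dotn l m"
  by (simp add: dotn_def sum_distrib_left mult_ac)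

definition multinom :: "nat ^ 'd \<Rightarrow> nat ^ 'd \<Rightarrow> rat" where
  "multinom l m = fact (dotn l m) / (\<Prod>i\<in>UNIV. fact (m $ i) ^ (l $ i))"

lemma multinom_neq_0 [simp]: "multinom l m \<noteq> 0"
  by (simp add: multinom_def)

lemma multinom_0_right [simp]: "multinom l 0 = 1"
  by (simp add: multinom_def)

lemma power_fact_dvd_fact: "(fact m ^ l :: nat) dvd fact (l * m)"
proof (induction l)
  case (Suc l)
  then have "fact m * fact m ^ l dvd (fact m * fact (l * m) :: nat)"
    by (rule mult_dvd_mono[OF dvd_refl])
  also have "\<dots> dvd fact (m + l * m)"
    by (rule fact_fact_dvd_fact)
  finally show ?case by simp
qed simp

lemma prod_power_fact_dvd_fact:
  "finite S \<Longrightarrow> (\<Prod>i\<in>S. fact (m i) ^ l i :: nat) dvd fact (\<Sum>i\<in>S. l i * m i)"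
proof (induction S rule: finite_induct)
  case (insert i S)
  have "fact (m i) ^ l i * (\<Prod>i\<in>S. fact (m i) ^ l i) dvd
      (fact (l i * m i) * fact (\<Sum>i\<in>S. l i * m i) :: nat)"
    using insert.IH power_fact_dvd_fact by (rule mult_dvd_mono[rotated])
  also have "\<dots> dvd fact (l i * m i + (\<Sum>i\<in>S. l i * m i))"
    by (rule fact_fact_dvd_fact)
  finally show ?case using insert.hyps by simp
qed simp

lemma multinom_Ints: "multinom l m \<in> \<int>"
proof -
  obtain c :: nat where "fact (dotn l m) = (\<Prod>i\<in>UNIV. fact (m $ i) ^ (l $ i)) * c"
    using prod_power_fact_dvd_fact[of UNIV "vec_nth m" "vec_nth l"] by (auto simp: dotn_def)
  then have "rat_of_nat (fact (dotn l m)) = of_nat ((\<Prod>i\<in>UNIV. fact (m $ i) ^ (l $ i)) * c)"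
    by presburger
  then have "multinom l m = of_nat c"
    by (simp add: multinom_def)
  then show ?thesis by simp
qed

text \<open>This is how \<open>L \<le> N 1\<close> is exploited: \<open>multinom l m\<close> splits
  off with an integral cofactor, so denominators of the harmonic numbers can be charged to
  \<open>multinom l m\<close> alone.\<close>

lemma multinom_add:
  "multinom (l + l') m =
    multinom l m * multinom l' m * of_nat (dotn l m + dotn l' m choose dotn l m)"
  by (simp add: multinom_def dotn_add_left binomial_fact power_add prod.distrib)

section \<open>Factorials without their multiples of \<open>p\<close>, and the ratios of
  multinomials\<close>

context prime_localization
begin

text \<open>Up to sign, the value at \<open>n + 1\<close> of Morita's \<open>p\<close>-adic gamma
  function.\<close>

primrec pfree_fact :: "nat \<Rightarrow> nat" where
  "pfree_fact 0 = 1"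
| "pfree_fact (Suc n) = (if p dvd Suc n then 1 else Suc n) * pfree_fact n"

lemma not_dvd_pfree_fact: "\<not> p dvd pfree_fact n"
  using prime_p by (induction n) (auto simp: prime_dvd_mult_iff)

lemma pfree_fact_neq_0 [simp]: "pfree_fact n \<noteq> 0"
  using not_dvd_pfree_fact[of n] by (metis dvd_0_right)

text \<open>The multiples of \<open>p\<close> up to \<open>n\<close> are \<open>p\<close> times the
  numbers from 1 to \<open>n div p\<close>.\<close>

lemma fact_eq_pfree_fact: "fact n = pfree_fact n * p ^ (n div p) * fact (n div p)"
proof (induction n)
  case (Suc n)
  show ?case
  proof (cases "p dvd Suc n")
    case True
    then have d: "Suc n div p = Suc (n div p)"
      by (simp add: div_Suc dvd_eq_mod_eq_0)
    have "Suc n = p * Suc (n div p)"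
      using True d by (metis dvd_mult_div_cancel)
    have "fact (Suc n) = Suc n * (fact n :: nat)" by simp
    also have "\<dots> = p * Suc (n div p) * fact n"
      using \<open>Suc n = p * Suc (n div p)\<close> by presburger
    finally show ?thesis using True unfolding Suc d by (simp add: algebra_simps)
  next
    case False
    then have "Suc n div p = n div p"
      by (simp add: div_Suc dvd_eq_mod_eq_0)
    then show ?thesis using False by (simp add: Suc algebra_simps)
  qed
qed simp

text \<open>Because \<open>p\<close> divides \<open>q\<close>, a shift by \<open>q\<close> preserves
  both the residue modulo \<open>q\<close> and divisibility by \<open>p\<close>; hence the factors
  beyond \<open>q\<close> repeat those of \<open>pfree_fact n\<close>.\<close>

lemma pfree_fact_add_cong:
  assumes "p dvd q"
  shows "[pfree_fact (n + q) = pfree_fact n * pfree_fact q] (mod q)"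
proof (induction n)
  case (Suc n)
  have "p dvd Suc (n + q) \<longleftrightarrow> p dvd Suc n"
    using assms by (metis add_Suc dvd_add_left_iff)
  moreover have "[Suc (n + q) * pfree_fact (n + q) = Suc n * (pfree_fact n * pfree_fact q)] (mod q)"
    by (intro cong_mult Suc.IH) (simp add: cong_def flip: add_Suc)
  ultimately show ?case using Suc.IH by (cases "p dvd Suc n") (simp_all add: mult.assoc del: mult_Suc One_nat_def)
qed simp

lemma pfree_fact_add_mult_cong:
  assumes "p dvd q"
  shows "[pfree_fact (n + q * c) = pfree_fact n * pfree_fact q ^ c] (mod q)"
proof (induction c)
  case (Suc c)
  have "[pfree_fact ((n + q * c) + q) = pfree_fact (n + q * c) * pfree_fact q] (mod q)"
    by (rule pfree_fact_add_cong[OF assms])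
  also have "[pfree_fact (n + q * c) * pfree_fact q = pfree_fact n * pfree_fact q ^ c * pfree_fact q] (mod q)"
    by (intro cong_mult Suc.IH cong_refl)
  finally show ?case by (simp add: algebra_simps)
qed simp

definition digits :: "nat ^ 'd \<Rightarrow> bool" where
  "digits v \<longleftrightarrow> (\<forall>i. v $ i < p)"

definition unit_part :: "nat ^ 'd \<Rightarrow> nat ^ 'd \<Rightarrow> rat" where
  "unit_part l m =
    of_nat (pfree_fact (dotn l m)) * inverse (of_nat (\<Prod>i\<in>UNIV. pfree_fact (m $ i) ^ (l $ i)))"

text \<open>The contribution of the carry: \<open>dotn l (v + p *s w) div p\<close> exceeds
  \<open>dotn l w\<close> by \<open>dotn l v div p\<close>, which leaves that many powers of
  \<open>p\<close> and that many further factors of a factorial.\<close>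

definition ratio_part :: "nat ^ 'd \<Rightarrow> nat ^ 'd \<Rightarrow> nat ^ 'd \<Rightarrow> nat" where
  "ratio_part l v w = p ^ (dotn l v div p) * (\<Prod>t=1..dotn l v div p. dotn l w + t)"

lemma not_dvd_prod_pfree_fact: "\<not> p dvd (\<Prod>i\<in>S. pfree_fact (f i) ^ g i)"
  using prime_p not_dvd_pfree_fact
  by (induction S rule: infinite_finite_induct)
    (auto simp: prime_dvd_mult_iff dest: prime_dvd_power)

lemma unit_part_pint: "unit_part l m \<in> pint p"
  unfolding unit_part_def
  by (intro pint_mult pint_of_nat pint_inverse_of_nat not_dvd_prod_pfree_fact)

lemma fact_add_eq: "fact (x + e) = fact x * (\<Prod>t=1..e. x + t :: nat)"
  by (induction e) (simp_all add: algebra_simps)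

text \<open>The multiples of \<open>p\<close> are split off every factorial. Since \<open>v\<close>
  consists of digits, the factorials in the denominator leave exactly \<open>fact (w $ i)\<close>,
  while the numerator leaves \<open>fact (x + e)\<close> with the carry \<open>e\<close>; the common
  power \<open>p ^ x\<close> cancels.\<close>

lemma multinom_ratio:
  assumes "digits v"
  shows "multinom l (v + p *s w) =
    multinom l w * (unit_part l (v + p *s w) * of_nat (ratio_part l v w))"
proof -
  define e where "e = dotn l v div p"
  define x where "x = dotn l w"
  have p0: "p > 0" using prime_gt_0_nat[OF prime_p] .
  have d: "dotn l (v + p *s w) div p = x + e"
    using p0 by (simp add: dotn_add_right dotn_smult_right e_def x_def)
  have n: "(fact (dotn l (v + p *s w)) :: rat) =
      of_nat (pfree_fact (dotn l (v + p *s w))) * of_nat p ^ x * fact x * of_nat (ratio_part l v w)"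
  proof -
    have "fact (dotn l (v + p *s w)) =
        pfree_fact (dotn l (v + p *s w)) * p ^ (x + e) * (fact x * (\<Prod>t=1..e. x + t))"
      using fact_eq_pfree_fact[of "dotn l (v + p *s w)"] unfolding d fact_add_eq .
    also have "\<dots> = pfree_fact (dotn l (v + p *s w)) * p ^ x * fact x * ratio_part l v w"
      by (simp add: ratio_part_def power_add e_def x_def)
    finally show ?thesis by (metis of_nat_fact of_nat_mult of_nat_power)
  qed
  have f: "(fact ((v + p *s w) $ i) :: rat) =
      of_nat (pfree_fact ((v + p *s w) $ i)) * of_nat p ^ (w $ i) * fact (w $ i)" for i
  proof -
    have "(v + p *s w) $ i div p = w $ i"
      using assms p0 by (simp add: digits_def)
    then show ?thesis
      using fact_eq_pfree_fact[of "(v + p *s w) $ i"] by (metis of_nat_fact of_nat_mult of_nat_power)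
  qed
  have "(\<Prod>i\<in>UNIV. fact ((v + p *s w) $ i) ^ (l $ i) :: rat) =
      of_nat (\<Prod>i\<in>UNIV. pfree_fact ((v + p *s w) $ i) ^ (l $ i)) * of_nat p ^ x *
      (\<Prod>i\<in>UNIV. fact (w $ i) ^ (l $ i))"
    unfolding f
    by (simp add: power_mult_distrib prod.distrib x_def dotn_def power_sum mult.commute
        flip: power_mult)
  then show ?thesis
    unfolding multinom_def n unit_part_def using of_nat_p_neq_0
    by (simp add: field_simps x_def)
qed

text \<open>
  The product over a full period is the same unit modulo \<open>q\<close> in the numerator and in the denominator,
  so it cancels and its value (Wilson's theorem) is irrelevant.
\<close>

lemma unit_part_cong:
  assumes "p dvd q"
  shows "unit_part l (m + q *s n) - unit_part l m \<in> pideal p (of_nat q)"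
proof -
  define W where "W = pfree_fact q ^ dotn l n"
  define D where "D m = (\<Prod>i\<in>UNIV. pfree_fact (m $ i) ^ (l $ i))" for m
  have D0: "rat_of_nat (D m) \<noteq> 0" for m by (simp add: D_def)
  have W0: "rat_of_nat W \<noteq> 0" by (simp add: W_def)
  have pD: "\<not> p dvd D m" for m by (simp add: D_def not_dvd_prod_pfree_fact)
  have pW: "\<not> p dvd W" using prime_p not_dvd_pfree_fact by (auto simp: W_def dest: prime_dvd_power)
  then have pDW: "\<not> p dvd D m * W" for m using prime_p pD by (simp add: prime_dvd_mult_iff)
  have 1: "[pfree_fact (dotn l (m + q *s n)) = pfree_fact (dotn l m) * W] (mod q)"
    unfolding W_def dotn_add_right dotn_smult_right by (rule pfree_fact_add_mult_cong[OF assms])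
  have "[D (m + q *s n) = (\<Prod>i\<in>UNIV. (pfree_fact (m $ i) * pfree_fact q ^ (n $ i)) ^ (l $ i))] (mod q)"
    unfolding D_def
    by (intro cong_prod cong_pow) (simp add: pfree_fact_add_mult_cong[OF assms])
  also have "(\<Prod>i\<in>UNIV. (pfree_fact (m $ i) * pfree_fact q ^ (n $ i)) ^ (l $ i)) = D m * W"
    by (simp add: D_def W_def dotn_def power_mult_distrib prod.distrib power_sum mult.commute
        flip: power_mult)
  finally have 2: "[D (m + q *s n) = D m * W] (mod q)" .
  have "of_nat (pfree_fact (dotn l (m + q *s n))) * inverse (of_nat (D (m + q *s n))) -
      of_nat (pfree_fact (dotn l m) * W) * inverse (of_nat (D m * W)) \<in> pideal p (of_nat q)"
    using D0 W0 pD pDW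
    by (intro pideal_mult_cong pideal_inverse_cong pideal_of_nat_cong 1 2 pint_of_nat
        pint_inverse_of_nat) auto
  moreover have "of_nat (pfree_fact (dotn l m) * W) * inverse (rat_of_nat (D m * W)) = unit_part l m"
    using D0 W0 by (simp add: unit_part_def D_def)
  ultimately show ?thesis by (simp only: unit_part_def D_def)
qed

text \<open>The product alone is only constant modulo \<open>p ^ s\<close>. The missing factor
  \<open>p\<close> comes from the power in front, which is nontrivial as soon as the product is
  nonempty.\<close>

lemma ratio_part_cong:
  "[ratio_part l v (w + p ^ s *s n) = ratio_part l v w] (mod p ^ Suc s)"
proof (cases "dotn l v div p")
  case 0
  then show ?thesis by (simp add: ratio_part_def)
next
  case (Suc e)
  define P where "P w = (\<Prod>t=1..Suc e. dotn l w + t)" for w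
  have "[P (w + p ^ s *s n) = P w] (mod p ^ s)"
    unfolding P_def
    by (intro cong_prod) (simp add: dotn_add_right dotn_smult_right cong_def add.assoc add.left_commute[of "dotn l w"])
  then have "[p * P (w + p ^ s *s n) = p * P w] (mod p * p ^ s)"
    by (simp add: cong_def flip: mult_mod_right)
  then have "[p ^ e * (p * P (w + p ^ s *s n)) = p ^ e * (p * P w)] (mod p ^ Suc s)"
    unfolding power_Suc by (rule cong_mult[OF cong_refl])
  then show ?thesis by (simp add: ratio_part_def Suc P_def mult_ac)
qed

definition ratio :: "nat ^ 'd \<Rightarrow> nat ^ 'd \<Rightarrow> nat ^ 'd \<Rightarrow> rat" where
  "ratio l v w = multinom l (v + p *s w) / multinom l w"

lemma ratio_eq: "digits v \<Longrightarrow> ratio l v w = unit_part l (v + p *s w) * of_nat (ratio_part l v w)"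
  by (simp add: ratio_def multinom_ratio)

lemma ratio_pint: "digits v \<Longrightarrow> ratio l v w \<in> pint p"
  by (auto simp: ratio_eq unit_part_pint)

lemma ratio_cong:
  assumes "digits v"
  shows "ratio l v (w + p ^ s *s n) - ratio l v w \<in> pideal p (of_nat p ^ Suc s)"
proof -
  \<comment> \<open>A shift of \<open>w\<close> by a multiple of \<open>p ^ s\<close> moves the full
    argument by a multiple of \<open>p ^ Suc s\<close>, so the unit part also gains a power of
    \<open>p\<close>.\<close>
  have "v + p *s (w + p ^ s *s n) = (v + p *s w) + p ^ Suc s *s n"
    by (simp add: vec_eq_iff algebra_simps)
  then have "unit_part l (v + p *s (w + p ^ s *s n)) - unit_part l (v + p *s w)
      \<in> pideal p (of_nat (p ^ Suc s))"
    using unit_part_cong[of "p ^ Suc s"] by simp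
  then show ?thesis
    unfolding ratio_eq[OF assms]
    using pideal_of_nat_cong[OF ratio_part_cong, of l v w s n]
    by (intro pideal_mult_cong unit_part_pint pint_of_nat) simp_all
qed

text \<open>The divisor \<open>p * (dotn l w + t)\<close> occurs in \<open>ratio_part l v w\<close>:
  one factor of the product, and one of the powers of \<open>p\<close>, of which there is at least
  one.\<close>

lemma multinom_divide_pint:
  assumes "digits v" "t \<ge> 1" "t \<le> dotn l v div p"
  shows "multinom l (v + p *s w) / of_nat (p * (dotn l w + t)) \<in> pint p"
proof -
  have "dotn l w + t dvd (\<Prod>t=1..dotn l v div p. dotn l w + t)"
    using assms by (intro dvd_prodI) auto
  moreover have "p dvd p ^ (dotn l v div p)"
    using assms by (intro dvd_power) auto
  ultimately have "p * (dotn l w + t) dvd ratio_part l v w"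
    unfolding ratio_part_def by (metis mult_dvd_mono)
  then obtain c where c: "ratio_part l v w = p * (dotn l w + t) * c" ..
  have "of_nat (p * (dotn l w + t)) \<noteq> (0 :: rat)"
    using assms prime_gt_0_nat[OF prime_p] by (simp only: of_nat_eq_0_iff) simp
  then have "multinom l (v + p *s w) / of_nat (p * (dotn l w + t)) =
      multinom l w * (unit_part l (v + p *s w) * of_nat c)"
    unfolding multinom_ratio[OF assms(1)] c of_nat_mult[of "p * (dotn l w + t)" c]
    by (simp del: of_nat_add of_nat_mult of_nat_eq_0_iff)
  moreover have "multinom l w * (unit_part l (v + p *s w) * of_nat c) \<in> pint p"
    by (intro pint_mult unit_part_pint pint_of_nat pint_Ints[OF multinom_Ints])
  ultimately show ?thesis by simp
qed

lemma prime_power_divide_pint: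
  assumes "t > 0" "\<not> p ^ Suc s dvd t"
  shows "of_nat p ^ s / of_nat t \<in> pint p"
proof -
  obtain k t' where t: "t = p ^ k * t'" "\<not> p dvd t'"
    using assms(1) prime_p multiplicity_decompose'[of t p] by (metis not_gr0 not_prime_unit)
  have "k \<le> s"
    using assms(2) t by (metis dvd_mult2 le_imp_power_dvd not_less_eq_eq)
  then have "of_nat p ^ s / of_nat t = (of_nat p ^ (s - k) * inverse (of_nat t') :: rat)"
    using of_nat_p_neq_0 by (simp add: t power_diff field_simps)
  then show ?thesis
    using t(2) by (auto intro!: pint_mult pint_power pint_inverse_of_nat)
qed

section \<open>Denominators of harmonic numbers\<close>

lemma harmonic_diff:
  assumes "a \<le> b"
  shows "harmonic b - harmonic a = (\<Sum>t\<in>{a<..b}. 1 / of_nat t)"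
proof -
  have "{1..b} = {1..a} \<union> {a<..b}" using assms by auto
  then have "harmonic b = harmonic a + (\<Sum>t\<in>{a<..b}. 1 / of_nat t)"
    unfolding harmonic_def by (simp add: sum.union_disjoint ivl_disj_int)
  then show ?thesis by simp
qed

text \<open>The difference is a sum of reciprocals \<open>1 / t\<close>. If \<open>p ^ Suc s\<close>
  does not divide \<open>t\<close>, the factor \<open>p ^ s\<close> clears its denominator at
  \<open>p\<close>. Otherwise \<open>t = p ^ Suc s * (x + u)\<close>, the range of \<open>t\<close>
  forces \<open>1 \<le> u \<le> y div p\<close>, and the remaining denominator
  \<open>p * (x + u)\<close> is absorbed by the multinomial.\<close>

lemma multinom_harmonic_pint:
  assumes "digits v"
  shows "multinom l (v + p *s w) * of_nat p ^ s *
    (harmonic (p ^ s * dotn l (v + p *s w)) - harmonic (p ^ Suc s * dotn l w)) \<in> pint p"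
proof -
  define x y where "x = dotn l w" and "y = dotn l v"
  have xy: "dotn l (v + p *s w) = p * x + y"
    by (simp add: dotn_add_right dotn_smult_right x_def y_def)
  have p0: "p > 0" using prime_gt_0_nat[OF prime_p] .
  have "multinom l (v + p *s w) * (of_nat p ^ s / of_nat t) \<in> pint p"
    if t: "t \<in> {p ^ Suc s * x<..p ^ s * (p * x + y)}" for t
  proof (cases "p ^ Suc s dvd t")
    case False
    then show ?thesis
      using t by (intro pint_mult prime_power_divide_pint pint_Ints multinom_Ints) auto
  next
    case True
    then obtain c where c: "t = p ^ Suc s * c" ..
    from t have "x < c" using c p0 by simp
    moreover from t have "p * c \<le> p * x + y" using c p0 by (simp add: mult_ac)
    ultimately obtain u where u: "c = x + u" "u \<ge> 1" "p * u \<le> y"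
      by (intro that[of "c - x"]) (auto simp: diff_mult_distrib2)
    then have "u \<le> y div p" using p0 by (simp add: less_eq_div_iff_mult_less_eq mult.commute)
    then have "multinom l (v + p *s w) / of_nat (p * (x + u)) \<in> pint p"
      using assms u unfolding x_def y_def by (intro multinom_divide_pint) auto
    moreover have "of_nat p ^ s / of_nat t = (1 / of_nat (p * (x + u)) :: rat)"
      using of_nat_p_neq_0 by (simp add: c u)
    ultimately show ?thesis by simp
  qed
  then have "(\<Sum>t\<in>{p ^ Suc s * x<..p ^ s * (p * x + y)}.
      multinom l (v + p *s w) * (of_nat p ^ s / of_nat t)) \<in> pint p"
    by blast
  moreover have "p ^ Suc s * x \<le> p ^ s * (p * x + y)" by (simp add: algebra_simps)
  ultimately show ?thesis
    unfolding xy x_def[symmetric]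
    by (subst harmonic_diff) (simp_all add: sum_distrib_left mult.assoc)
qed

text \<open>The terms of \<open>harmonic (p * x)\<close> at multiples of \<open>p\<close> sum to
  \<open>harmonic x / p\<close>; all others are \<open>p\<close>-integral. The induction adds one
  block of \<open>p\<close> terms at a time.\<close>

lemma harmonic_mult_p: "of_nat p * harmonic (p * x) - harmonic x \<in> pideal p (of_nat p)"
proof (induction x)
  case 0
  then show ?case by (simp add: harmonic_def)
next
  case (Suc x)
  have p0: "p > 0" using prime_gt_0_nat[OF prime_p] .
  have "{p * x<..p * Suc x} = insert (p * Suc x) {p * x<..<p * Suc x}"
    using p0 by auto
  then have "harmonic (p * Suc x) - harmonic (p * x) =
      1 / of_nat (p * Suc x) + (\<Sum>t\<in>{p * x<..<p * Suc x}. 1 / of_nat t)"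
    by (subst harmonic_diff) (simp_all del: mult_Suc_right of_nat_Suc of_nat_mult)
  moreover have "harmonic (Suc x) = harmonic x + 1 / of_nat (Suc x)"
    by (simp add: harmonic_def)
  moreover have "of_nat p * (1 / of_nat (p * Suc x)) = (1 / of_nat (Suc x) :: rat)"
    using of_nat_p_neq_0 unfolding of_nat_mult by (simp del: of_nat_Suc)
  ultimately have "of_nat p * harmonic (p * Suc x) - harmonic (Suc x) =
      (of_nat p * harmonic (p * x) - harmonic x) +
      of_nat p * (\<Sum>t\<in>{p * x<..<p * Suc x}. 1 / of_nat t)"
    by (simp add: algebra_simps del: of_nat_Suc of_nat_mult mult_Suc_right)
  moreover have "\<not> p dvd t" if "t \<in> {p * x<..<p * Suc x}" for t
    using that by (metis dvd_def greaterThanLessThan_iff less_Suc_eq_le linorder_not_less nat_mult_less_cancel1 p0)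
  then have "of_nat p * (\<Sum>t\<in>{p * x<..<p * Suc x}. 1 / of_nat t) \<in> pideal p (of_nat p)"
    by (intro pidealI pint_sum) (auto simp: pint_inverse_of_nat simp flip: inverse_eq_divide)
  ultimately show ?case using Suc.IH by auto
qed

end

section \<open>Dwork's formal congruences\<close>

lemma Suc_0_smult_vec [simp]: "Suc 0 *s m = m"
  by (simp add: vec_eq_iff)

context prime_localization
begin

definition box :: "nat \<Rightarrow> (nat ^ 'd) set" where
  "box s = {j. \<forall>i. j $ i < p ^ s}"

lemma finite_box [simp, intro]: "finite (box s :: (nat ^ 'd) set)"
proof -
  have "box s \<subseteq> {j :: nat ^ 'd. j \<le> (\<chi> i. p ^ s)}"
    by (auto simp: box_def less_eq_vec_def intro: less_imp_le)
  then show ?thesis using finite_le_nat_vec finite_subset by blast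
qed

lemma box_0 [simp]: "box 0 = {0}"
  by (auto simp: box_def vec_eq_iff)

lemma box_1: "box (Suc 0) = Collect digits"
  by (auto simp: box_def digits_def)

lemma zero_in_box [simp]: "0 \<in> box s"
  using prime_gt_0_nat[OF prime_p] by (simp add: box_def)

lemma box_mono: "s \<le> t \<Longrightarrow> box s \<subseteq> box t"
proof -
  assume "s \<le> t"
  then have "p ^ s \<le> p ^ t"
    using prime_gt_0_nat[OF prime_p] by (intro power_increasing) auto
  then show ?thesis unfolding box_def by (auto intro: less_le_trans)
qed

text \<open>The estimate \<open>n < 2 ^ n \<le> p ^ n\<close> is crude, but it suffices to place
  supports inside boxes. The slack \<open>s\<close> lets such a box be cut into boxes of side
  \<open>p ^ s\<close>.\<close>

lemma le_imp_in_box: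
  assumes "x \<le> K"
  shows "x \<in> box (s + mdegree K)"
proof -
  have "x $ i < p ^ (s + mdegree K)" for i
  proof -
    have "x $ i \<le> K $ i" using assms by (simp add: less_eq_vec_def)
    also have "\<dots> \<le> mdegree K" unfolding mdegree_def by (rule member_le_sum) auto
    also have "\<dots> < 2 ^ mdegree K" by (rule less_exp)
    also have "\<dots> \<le> p ^ mdegree K"
      using prime_ge_2_nat[OF prime_p] by (rule power_mono) simp
    also have "\<dots> \<le> p ^ (s + mdegree K)"
      using prime_gt_0_nat[OF prime_p] by (intro power_increasing) auto
    finally show ?thesis .
  qed
  then show ?thesis by (simp add: box_def)
qed

text \<open>Each coordinate is split into its lowest \<open>s\<close> digits in base
  \<open>p\<close> and the rest; \<open>M\<close> and \<open>D\<close> extract the two.\<close>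

lemma sum_box_add:
  fixes f :: "nat ^ 'a \<Rightarrow> 'b :: comm_monoid_add"
  shows "(\<Sum>x\<in>box (s + t). f x) = (\<Sum>j\<in>box s. \<Sum>i\<in>box t. f (j + p ^ s *s i))"
proof -
  have p0: "p ^ s > 0" for s using prime_gt_0_nat[OF prime_p] by simp
  have lt: "j + p ^ s * i < p ^ (s + t)" if "j < p ^ s" "i < p ^ t" for i j
  proof -
    have "j + p ^ s * i < p ^ s * Suc i" using that by simp
    also have "\<dots> \<le> p ^ s * p ^ t" using that by (intro mult_le_mono) auto
    finally show ?thesis by (simp add: power_add)
  qed
  define D M where "D = (\<lambda>x :: nat ^ 'a. \<chi> i. x $ i div p ^ s)"
    and "M = (\<lambda>x :: nat ^ 'a. \<chi> i. x $ i mod p ^ s)"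
  have 1: "M x + p ^ s *s D x = x" for x
    by (simp add: vec_eq_iff D_def M_def)
  have 2: "M x \<in> box s" for x
    using p0 by (simp add: box_def M_def)
  have 3: "D x \<in> box t" if "x \<in> box (s + t)" for x
    using that by (simp add: box_def D_def less_mult_imp_div_less power_add mult.commute)
  have 4: "j + p ^ s *s i \<in> box (s + t)" if "j \<in> box s" "i \<in> box t" for i j :: "nat ^ 'a"
    using that by (simp add: box_def lt)
  have 5: "D (j + p ^ s *s i) = i" "M (j + p ^ s *s i) = j" if "j \<in> box s" for i j
    using that p0[of s] by (simp_all add: box_def D_def M_def vec_eq_iff)
  show ?thesis
    unfolding sum.cartesian_product
    by (rule sum.reindex_bij_witness[where j = "\<lambda>x. (M x, D x)" and i = "\<lambda>(j, i). j + p ^ s *s i"])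
      (simp_all add: 1 2 3 split_beta 4 5 mem_Times_iff)
qed

end

lemma le_add_cancel_vec: "(a :: nat ^ 'd) + c \<le> b + c \<longleftrightarrow> a \<le> b"
  by (simp add: less_eq_vec_def)

lemma le_imp_diff_add_vec: "(a :: nat ^ 'd) \<le> b \<Longrightarrow> b - a + a = b"
  by (simp add: less_eq_vec_def vec_eq_iff)

lemma diff_le_vec: "(a :: nat ^ 'd) \<le> b \<Longrightarrow> b - a \<le> b"
  by (simp add: less_eq_vec_def)

lemma diff_diff_vec: "(a :: nat ^ 'd) \<le> b \<Longrightarrow> b - (b - a) = a"
  by (simp add: less_eq_vec_def vec_eq_iff)

lemma sum_le_vec_flip: "(\<Sum>j | j \<le> K. f j) = (\<Sum>j | j \<le> K. f (K - j))" for K :: "nat ^ 'd"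
  by (rule sum.reindex_bij_witness[where i = "\<lambda>j. K - j" and j = "\<lambda>j. K - j"])
    (auto simp: diff_le_vec diff_diff_vec)

text \<open>The values \<open>A w\<close> may be divisible by \<open>p\<close>, so the integrality
  of the ratios does not follow from that of \<open>A\<close>.\<close>

locale dwork = prime_localization p for p +
  fixes A :: "nat ^ 'd \<Rightarrow> rat"
  assumes A_neq_0: "A m \<noteq> 0"
    and A_0: "A 0 = 1"
    and A_pint: "A m \<in> pint p"
    and ratio_A_pint: "digits v \<Longrightarrow> A (v + p *s w) / A w \<in> pint p"
    and ratio_A_cong: "digits v \<Longrightarrow>
      A (v + p *s (w + p ^ s *s n)) / A (w + p ^ s *s n) - A (v + p *s w) / A w
        \<in> pideal p (of_nat p ^ Suc s)"
begin

text \<open>Stripping the lowest digits one by one writes \<open>A (u + p ^ s *s n) / A n\<close> as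
  a product of \<open>s\<close> ratios.\<close>

lemma A_add_pideal: "u \<in> box s \<Longrightarrow> A (u + p ^ s *s n) \<in> pideal p (A n)"
proof (induction s arbitrary: u)
  case 0
  then show ?case using pidealI[OF pint_1, of "A n"] by simp
next
  case (Suc s)
  have p0: "p > 0" using prime_gt_0_nat[OF prime_p] .
  define v w where "v = (\<chi> i. u $ i mod p)" and "w = (\<chi> i. u $ i div p)"
  have u: "u = v + p *s w" by (simp add: v_def w_def vec_eq_iff)
  have "digits v" using p0 by (simp add: v_def digits_def)
  have "w \<in> box s"
    using Suc.prems by (auto simp: box_def w_def less_mult_imp_div_less mult.commute)
  have e: "u + p ^ Suc s *s n = v + p *s (w + p ^ s *s n)"
    by (simp add: u vec_eq_iff algebra_simps)
  have "A (u + p ^ Suc s *s n) =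
      A (v + p *s (w + p ^ s *s n)) / A (w + p ^ s *s n) * A (w + p ^ s *s n)"
    unfolding e using A_neq_0 by simp
  also have "\<dots> \<in> pideal p (A n)"
    using ratio_A_pint[OF \<open>digits v\<close>] Suc.IH[OF \<open>w \<in> box s\<close>] by (rule pideal_mult_left)
  finally show ?case .
qed

text \<open>This is \<open>ratio_A_cong\<close> multiplied by \<open>A (u + p ^ s *s n)\<close>; by
  \<open>A_add_pideal\<close> that factor brings \<open>A n\<close> into the modulus.\<close>

lemma A_shift_cong:
  assumes "digits v" "u \<in> box s"
  shows "A (v + p *s u + p ^ Suc s *s n) - A (u + p ^ s *s n) / A u * A (v + p *s u)
    \<in> pideal p (of_nat p ^ Suc s * A n)"
proof -
  have e: "v + p *s u + p ^ Suc s *s n = v + p *s (u + p ^ s *s n)"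
    by (simp add: vec_eq_iff algebra_simps)
  have "A (v + p *s u + p ^ Suc s *s n) - A (u + p ^ s *s n) / A u * A (v + p *s u) =
      (A (v + p *s (u + p ^ s *s n)) / A (u + p ^ s *s n) - A (v + p *s u) / A u) * A (u + p ^ s *s n)"
    unfolding e using A_neq_0 by (simp add: field_simps)
  also have "\<dots> \<in> pideal p (of_nat p ^ Suc s * A n)"
    using ratio_A_cong[OF assms(1)] A_add_pideal[OF assms(2)] by (rule pideal_mult)
  finally show ?thesis .
qed

text \<open>The extension by zero permits sums over whole boxes and avoids the truncated values of
  \<open>K - j\<close>.\<close>

definition U :: "nat ^ 'd \<Rightarrow> nat ^ 'd \<Rightarrow> nat ^ 'd \<Rightarrow> rat" where
  "U a K j = (if j \<le> K then A (a + p *s (K - j)) * A j - A (K - j) * A (a + p *s j) else 0)"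

definition S :: "nat ^ 'd \<Rightarrow> nat \<Rightarrow> nat ^ 'd \<Rightarrow> nat ^ 'd \<Rightarrow> rat" where
  "S a s m K = (\<Sum>j\<in>box s. U a K (j + p ^ s *s m))"

lemma S_Suc: "S a (Suc s) m K = (\<Sum>i\<in>box 1. S a s (i + p *s m) K)"
proof -
  have "S a (Suc s) m K = (\<Sum>j\<in>box s. \<Sum>i\<in>box 1. U a K (j + p ^ s *s i + p ^ Suc s *s m))"
    unfolding S_def using sum_box_add[where s = s and t = 1] by simp
  also have "\<dots> = (\<Sum>i\<in>box 1. \<Sum>j\<in>box s. U a K (j + p ^ s *s i + p ^ Suc s *s m))"
    by (rule sum.swap)
  also have "\<dots> = (\<Sum>i\<in>box 1. S a s (i + p *s m) K)"
    unfolding S_def by (intro sum.cong refl arg_cong[of _ _ "U a K"]) (simp add: vec_eq_iff algebra_simps)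
  finally show ?thesis .
qed

text \<open>\<open>U a K\<close> is antisymmetric under the reflection of \<open>j\<close> to
  \<open>K - j\<close>.\<close>

lemma sum_U: "(\<Sum>j | j \<le> K. U a K j) = 0"
proof -
  have "(\<Sum>j | j \<le> K. U a K j) = (\<Sum>j | j \<le> K. U a K (K - j))"
    by (rule sum_le_vec_flip)
  also have "\<dots> = (\<Sum>j | j \<le> K. - U a K j)"
    by (intro sum.cong) (auto simp: U_def diff_le_vec diff_diff_vec)
  finally show ?thesis by (simp add: sum_negf)
qed

text \<open>
  At \<open>t = 0\<close> the right-hand sum replaces the shifted terms one by one; each increment of \<open>t\<close>
  merges the boxes of side \<open>p\<^sup>t\<close> into boxes of side \<open>p\<^bsup>t+1\<^esup>\<close>. The extreme case \<open>r = 0\<close> is the one of interest.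
\<close>

lemma S_shift_cong:
  assumes "digits a" "\<And>t' m K. t' < t \<Longrightarrow> S a t' m K \<in> pideal p (of_nat p ^ Suc t' * A m)"
  shows "S a (t + r) m (K + p ^ (t + r) *s m) - (\<Sum>j\<in>box r. A (j + p ^ r *s m) / A j * S a t j K)
    \<in> pideal p (of_nat p ^ Suc (t + r) * A m)"
  using assms(2)
proof (induction t arbitrary: r)
  case 0
  have "U a (K + p ^ r *s m) (j + p ^ r *s m) - A (j + p ^ r *s m) / A j * U a K j
      \<in> pideal p (of_nat p ^ Suc r * A m)" if j: "j \<in> box r" for j
  proof (cases "j \<le> K")
    case False
    then show ?thesis by (simp add: U_def le_add_cancel_vec)
  next
    case True
    have e: "a + p *s (j + p ^ r *s m) = a + p *s j + p ^ Suc r *s m"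
      by (simp add: vec_eq_iff algebra_simps)
    \<comment> \<open>Shifting \<open>j\<close> and \<open>K\<close> together leaves
      \<open>K - j\<close> fixed, so the first products in the two values of \<open>U\<close> cancel
      exactly.\<close>
    have "U a (K + p ^ r *s m) (j + p ^ r *s m) - A (j + p ^ r *s m) / A j * U a K j =
        - (A (K - j) * (A (a + p *s j + p ^ Suc r *s m) - A (j + p ^ r *s m) / A j * A (a + p *s j)))"
      using True A_neq_0[of j]
      unfolding U_def e by (simp add: le_add_cancel_vec field_simps del: power_Suc)
    also have "\<dots> \<in> pideal p (of_nat p ^ Suc r * A m)"
      by (intro pideal_uminus pideal_mult_left A_pint A_shift_cong assms(1) j)
    finally show ?thesis .
  qed
  then have "(\<Sum>j\<in>box r. U a (K + p ^ r *s m) (j + p ^ r *s m) - A (j + p ^ r *s m) / A j * U a K j)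
      \<in> pideal p (of_nat p ^ Suc r * A m)"
    by (rule pideal_sum)
  then show ?case by (simp add: S_def sum_subtractf del: power_Suc)
next
  case (Suc t)
  let ?c = "of_nat p ^ Suc (Suc t + r) * A m"
  \<comment> \<open>Passing from \<open>r\<close> to \<open>Suc r\<close> keeps the total exponent,
    so only the two right-hand sums remain to be compared.\<close>
  have IH: "S a (Suc t + r) m (K + p ^ (Suc t + r) *s m) -
      (\<Sum>j\<in>box (1 + r). A (j + p ^ Suc r *s m) / A j * S a t j K) \<in> pideal p ?c"
    using Suc.IH[of "Suc r"] Suc.prems by (simp del: power_Suc)
  \<comment> \<open>The assumed divisibility of \<open>S a t\<close> by
    \<open>A (i + p *s u)\<close> cancels the denominator, and its factor \<open>p ^ Suc t\<close>
    supplements the \<open>p ^ Suc r\<close> from \<open>A_shift_cong\<close>.\<close>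
  have *: "(A (i + p *s u + p ^ Suc r *s m) / A (i + p *s u) - A (u + p ^ r *s m) / A u) *
      S a t (i + p *s u) K \<in> pideal p ?c" if "i \<in> box 1" "u \<in> box r" for i u
  proof -
    have "digits i" using that by (simp add: box_1)
    obtain y where y: "S a t (i + p *s u) K = of_nat p ^ Suc t * A (i + p *s u) * y" "y \<in> pint p"
      using Suc.prems[of t "i + p *s u" K] by (auto simp: pideal_def)
    have "(A (i + p *s u + p ^ Suc r *s m) / A (i + p *s u) - A (u + p ^ r *s m) / A u) *
        S a t (i + p *s u) K =
        (A (i + p *s u + p ^ Suc r *s m) - A (u + p ^ r *s m) / A u * A (i + p *s u)) *
        (of_nat p ^ Suc t * y)"
      unfolding y(1) using A_neq_0[of "i + p *s u"] by (simp add: field_simps del: power_Suc)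
    also have "\<dots> \<in> pideal p (of_nat p ^ Suc r * A m * of_nat p ^ Suc t)"
      using A_shift_cong[OF \<open>digits i\<close> that(2)] pidealI[OF y(2)] by (rule pideal_mult)
    also have "of_nat p ^ Suc r * A m * of_nat p ^ Suc t = ?c"
      by (simp add: power_add)
    finally show ?thesis .
  qed
  have "(\<Sum>j\<in>box (1 + r). A (j + p ^ Suc r *s m) / A j * S a t j K) -
      (\<Sum>j\<in>box r. A (j + p ^ r *s m) / A j * S a (Suc t) j K) =
      (\<Sum>i\<in>box 1. \<Sum>u\<in>box r. A (i + p *s u + p ^ Suc r *s m) / A (i + p *s u) * S a t (i + p *s u) K) -
      (\<Sum>i\<in>box 1. \<Sum>u\<in>box r. A (u + p ^ r *s m) / A u * S a t (i + p *s u) K)"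
    unfolding S_Suc sum_distrib_left
    by (subst sum.swap[of _ "box r"]) (subst sum_box_add, simp del: power_Suc)
  also have "\<dots> = (\<Sum>i\<in>box 1. \<Sum>u\<in>box r.
      (A (i + p *s u + p ^ Suc r *s m) / A (i + p *s u) - A (u + p ^ r *s m) / A u) *
      S a t (i + p *s u) K)"
    by (simp only: left_diff_distrib sum_subtractf)
  also have "\<dots> \<in> pideal p ?c"
    by (intro pideal_sum *)
  finally have "(\<Sum>j\<in>box (1 + r). A (j + p ^ Suc r *s m) / A j * S a t j K) -
      (\<Sum>j\<in>box r. A (j + p ^ r *s m) / A j * S a (Suc t) j K) \<in> pideal p ?c" .
  from pideal_add[OF IH this] show ?case by simp
qed

text \<open>The shift congruence with \<open>r = 0\<close> reduces every box to the one at the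
  origin. There, the sum over all boxes vanishes by \<open>sum_U\<close>, so the box at the origin
  is minus the sum of the others; those are again reduced to the origin, but with \<open>K\<close>
  of smaller degree. Hence an inner induction on \<open>mdegree K\<close>.\<close>

theorem S_pideal:
  assumes "digits a"
  shows "S a s m K \<in> pideal p (of_nat p ^ Suc s * A m)"
proof (induction s arbitrary: m K rule: less_induct)
  case (less s)
  have shift: "S a s m (K + p ^ s *s m) - A m * S a s 0 K \<in> pideal p (of_nat p ^ Suc s * A m)" for m K
    using S_shift_cong[OF assms less.IH, of s 0 m K] by (simp add: A_0 del: power_Suc)
  have S_eq_0: "S a s m K = 0" if "\<not> p ^ s *s m \<le> K" for m K
  proof -
    have "\<not> j + p ^ s *s m \<le> K" for j
      using that by (auto simp: less_eq_vec_def intro: add_leD2)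
    then show ?thesis by (simp add: S_def U_def)
  qed
  have zero: "S a s 0 K \<in> pideal p (of_nat p ^ Suc s)" for K
  proof (induction "mdegree K" arbitrary: K rule: less_induct)
    case less
    have "(\<Sum>m\<in>box (mdegree K). S a s m K) = (\<Sum>x\<in>box (s + mdegree K). U a K x)"
      unfolding S_def by (subst sum.swap) (rule sum_box_add[symmetric])
    also have "\<dots> = (\<Sum>j | j \<le> K. U a K j)"
      by (rule sum.mono_neutral_right) (auto simp: le_imp_in_box U_def)
    finally have "(\<Sum>m\<in>box (mdegree K). S a s m K) = 0"
      by (simp add: sum_U)
    then have "S a s 0 K = - (\<Sum>m\<in>box (mdegree K) - {0}. S a s m K)"
      by (simp add: sum.remove[of _ 0] eq_neg_iff_add_eq_0)
    also have "\<dots> \<in> pideal p (of_nat p ^ Suc s)"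
    proof (intro pideal_uminus pideal_sum)
      fix m :: "nat ^ 'd"
      assume "m \<in> box (mdegree K) - {0}"
      then have m: "m \<noteq> 0" by simp
      show "S a s m K \<in> pideal p (of_nat p ^ Suc s)"
      proof (cases "p ^ s *s m \<le> K")
        case True
        define K' where "K' = K - p ^ s *s m"
        have K: "K = K' + p ^ s *s m" using True by (simp add: K'_def le_imp_diff_add_vec)
        have "mdegree (p ^ s *s m) \<noteq> 0"
          using m prime_gt_0_nat[OF prime_p] by (simp add: vec_eq_iff)
        then have "mdegree K' < mdegree K" unfolding K mdegree_add by linarith
        then have "A m * S a s 0 K' \<in> pideal p (of_nat p ^ Suc s)"
          by (intro pideal_mult_left A_pint less.hyps)
        moreover have "S a s m K - A m * S a s 0 K' \<in> pideal p (of_nat p ^ Suc s)"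
          unfolding K by (rule pideal_subset[OF shift A_pint])
        ultimately show ?thesis using pideal_add by fastforce
      qed (simp add: S_eq_0)
    qed
    finally show ?case .
  qed
  show ?case
  proof (cases "p ^ s *s m \<le> K")
    case True
    define K' where "K' = K - p ^ s *s m"
    have K: "K = K' + p ^ s *s m" using True by (simp add: K'_def le_imp_diff_add_vec)
    have "S a s 0 K' * A m \<in> pideal p (of_nat p ^ Suc s * A m)"
      using pideal_mult[OF zero pidealI[OF pint_1]] by simp
    with shift[of m K'] have "S a s m K - A m * S a s 0 K' + S a s 0 K' * A m
        \<in> pideal p (of_nat p ^ Suc s * A m)"
      unfolding K by (rule pideal_add)
    then show ?thesis by (simp add: mult.commute del: power_Suc)
  qed (simp add: S_eq_0)
qed

end

text \<open>In \<open>h_diff_pint\<close>, the point \<open>p ^ Suc s *s w\<close> is the corner of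
  a box of side \<open>p ^ Suc s\<close>, and \<open>p ^ s *s (v + p *s w)\<close> is the corner of
  one of the boxes of side \<open>p ^ s\<close> that partition it.\<close>

locale dwork_log = dwork p A for p and A :: "nat ^ 'd \<Rightarrow> rat" +
  fixes h :: "nat ^ 'd \<Rightarrow> rat"
  assumes h_0: "h 0 = 0"
    and h_diff_pint: "digits v \<Longrightarrow>
      A (v + p *s w) * of_nat p ^ s * (h (p ^ s *s (v + p *s w)) - h (p ^ Suc s *s w)) \<in> pint p"
    and h_mult_p: "of_nat p * h (p *s w) - h w \<in> pideal p (of_nat p)"
begin

text \<open>Cutting a box into boxes of side \<open>p ^ s\<close> gives the same sums relative to
  the new corners, plus \<open>S\<close> times the change of \<open>h\<close> between corners. Of
  the factor \<open>p ^ Suc s * A\<close> in \<open>S\<close>, the part \<open>p ^ s * A\<close>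
  pays for the denominator of that change and one \<open>p\<close> is left.\<close>

lemma sum_box_U_h:
  assumes "digits a"
  shows "(\<Sum>j\<in>box s. U a K (j + p ^ s *s m) * (h (j + p ^ s *s m) - h (p ^ s *s m)))
    \<in> pideal p (of_nat p)"
proof (induction s arbitrary: m)
  case (Suc s)
  have e: "j + p ^ s *s i + p ^ Suc s *s m = j + p ^ s *s (i + p *s m)" for i j
    by (simp add: vec_eq_iff algebra_simps)
  have "(\<Sum>j\<in>box (Suc s). U a K (j + p ^ Suc s *s m) * (h (j + p ^ Suc s *s m) - h (p ^ Suc s *s m))) =
      (\<Sum>j\<in>box s. \<Sum>i\<in>box 1. U a K (j + p ^ s *s (i + p *s m)) *
        (h (j + p ^ s *s (i + p *s m)) - h (p ^ Suc s *s m)))"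
    unfolding e[symmetric] by (subst sum_box_add[where s = s and t = 1, symmetric]) simp
  also have "\<dots> = (\<Sum>i\<in>box 1. \<Sum>j\<in>box s. U a K (j + p ^ s *s (i + p *s m)) *
        (h (j + p ^ s *s (i + p *s m)) - h (p ^ Suc s *s m)))"
    by (rule sum.swap)
  also have "\<dots> = (\<Sum>i\<in>box 1. (\<Sum>j\<in>box s. U a K (j + p ^ s *s (i + p *s m)) *
        (h (j + p ^ s *s (i + p *s m)) - h (p ^ s *s (i + p *s m)))) +
        S a s (i + p *s m) K * (h (p ^ s *s (i + p *s m)) - h (p ^ Suc s *s m)))"
    unfolding S_def sum_distrib_right sum.distrib[symmetric]
    by (intro sum.cong refl) (simp add: algebra_simps)
  also have "\<dots> \<in> pideal p (of_nat p)"
  proof (rule pideal_sum, rule pideal_add[OF Suc.IH])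
    fix i :: "nat ^ 'd"
    assume "i \<in> box 1"
    then have "digits i" by (simp add: box_1)
    obtain y where y: "S a s (i + p *s m) K = of_nat p ^ Suc s * A (i + p *s m) * y" "y \<in> pint p"
      using S_pideal[OF assms, of s "i + p *s m" K] by (auto simp: pideal_def)
    have "S a s (i + p *s m) K * (h (p ^ s *s (i + p *s m)) - h (p ^ Suc s *s m)) =
        of_nat p * (y * (A (i + p *s m) * of_nat p ^ s *
          (h (p ^ s *s (i + p *s m)) - h (p ^ Suc s *s m))))"
      unfolding y(1) by simp
    also have "\<dots> \<in> pideal p (of_nat p)"
      by (intro pidealI pint_mult y h_diff_pint \<open>digits i\<close>)
    finally show "S a s (i + p *s m) K * (h (p ^ s *s (i + p *s m)) - h (p ^ Suc s *s m))
      \<in> pideal p (of_nat p)" .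
  qed
  finally show ?case .
qed simp

text \<open>The comparison passes through \<open>h (p *s w)\<close>: first
  \<open>h_diff_pint\<close> at \<open>s = 0\<close>, then \<open>h_mult_p\<close>.\<close>

lemma A_h_pideal:
  assumes "digits v"
  shows "A (v + p *s w) * (of_nat p * h (v + p *s w) - h w) \<in> pideal p (of_nat p)"
proof -
  have "A (v + p *s w) * (of_nat p * h (v + p *s w) - h w) =
      of_nat p * (A (v + p *s w) * of_nat p ^ 0 * (h (p ^ 0 *s (v + p *s w)) - h (p ^ Suc 0 *s w))) +
      A (v + p *s w) * (of_nat p * h (p *s w) - h w)"
    by (simp add: algebra_simps)
  also have "\<dots> \<in> pideal p (of_nat p)"
    by (intro pideal_add pidealI pideal_mult_left h_diff_pint h_mult_p A_pint assms)
  finally show ?thesis .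
qed

text \<open>By \<open>A_h_pideal\<close>, \<open>p * h (a + p *s (K - j))\<close> may be replaced by
  \<open>h (K - j)\<close>. Reflecting \<open>j\<close> in the terms with \<open>h (K - j)\<close>
  then collects the factor \<open>U a K j\<close> in front of \<open>h j\<close>.\<close>

lemma sum_A_h_pideal:
  assumes "digits a"
  shows "(\<Sum>j | j \<le> K. A (a + p *s (K - j)) * A j * (h j - of_nat p * h (a + p *s (K - j))))
    \<in> pideal p (of_nat p)"
proof -
  have "(\<Sum>j | j \<le> K. A (a + p *s (K - j)) * A j * h (K - j)) =
      (\<Sum>j | j \<le> K. A (K - j) * A (a + p *s j) * h j)"
    by (subst sum_le_vec_flip) (intro sum.cong, auto simp: diff_diff_vec)
  then have "(\<Sum>j | j \<le> K. A (a + p *s (K - j)) * A j * (h j - h (K - j))) =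
      (\<Sum>j | j \<le> K. A (a + p *s (K - j)) * A j * h j) - (\<Sum>j | j \<le> K. A (K - j) * A (a + p *s j) * h j)"
    by (simp add: right_diff_distrib sum_subtractf)
  also have "\<dots> = (\<Sum>j | j \<le> K. U a K j * h j)"
    by (simp add: U_def left_diff_distrib flip: sum_subtractf)
  \<comment> \<open>A single box at the origin contains the support of \<open>U a K\<close>, and
    \<open>h\<close> vanishes at its corner.\<close>
  also have "\<dots> = (\<Sum>j\<in>box (0 + mdegree K). U a K j * h j)"
    by (rule sum.mono_neutral_left) (auto intro: le_imp_in_box[of _ K 0, simplified] simp: U_def)
  also have "\<dots> \<in> pideal p (of_nat p)"
    using sum_box_U_h[OF assms, of K "mdegree K" 0] by (simp add: h_0)
  finally have 1: "(\<Sum>j | j \<le> K. A (a + p *s (K - j)) * A j * (h j - h (K - j)))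
    \<in> pideal p (of_nat p)" .
  have 2: "(\<Sum>j | j \<le> K. A j * (A (a + p *s (K - j)) * (of_nat p * h (a + p *s (K - j)) - h (K - j))))
    \<in> pideal p (of_nat p)"
    by (intro pideal_sum pideal_mult_left A_pint A_h_pideal assms)
  have "(\<Sum>j | j \<le> K. A (a + p *s (K - j)) * A j * (h j - of_nat p * h (a + p *s (K - j)))) =
      (\<Sum>j | j \<le> K. A (a + p *s (K - j)) * A j * (h j - h (K - j))) -
      (\<Sum>j | j \<le> K. A j * (A (a + p *s (K - j)) * (of_nat p * h (a + p *s (K - j)) - h (K - j))))"
    by (simp add: algebra_simps flip: sum_subtractf)
  then show ?thesis using pideal_diff[OF 1 2] by simp
qed

end

section \<open>The Euler operator and the exponential\<close>

lemma mfps_coeff_of_nat_mult [simp]: "mfps_coeff (of_nat n * F) m = of_nat n * mfps_coeff F m"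
  by (induction n) (simp_all add: distrib_right)

lemma mfps_coeff_mult_diff:
  "mfps_coeff (F * G) m = (\<Sum>j | j \<le> m. mfps_coeff F (m - j) * mfps_coeff G j)"
  unfolding mfps_coeff_mult
  by (rule sum.reindex_bij_witness[where i = "\<lambda>j. (m - j, j)" and j = snd])
    (auto simp: splits_def le_imp_diff_add_vec less_eq_vec_def)

lemma mfps_coeff_mult_0: "mfps_coeff (F * G) 0 = mfps_coeff F 0 * mfps_coeff G 0"
  by (simp add: mfps_coeff_mult)

lemma mfps_coeff_power_0: "mfps_coeff (F ^ n) 0 = mfps_coeff F 0 ^ n"
  by (induction n) (simp_all add: mfps_coeff_mult_0 mfps_coeff_1)

lemma mfps_coeff_mult_lowest:
  assumes "\<And>b. mdegree b < mdegree m \<Longrightarrow> mfps_coeff R b = 0"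
  shows "mfps_coeff (R * Z) m = mfps_coeff R m * mfps_coeff Z 0"
proof -
  have "(\<Sum>(a, b)\<in>splits m. mfps_coeff R a * mfps_coeff Z b) =
      (\<Sum>(a, b)\<in>{(m, 0)}. mfps_coeff R a * mfps_coeff Z b)"
  proof (rule sum.mono_neutral_right[OF finite_splits])
    show "\<forall>x\<in>splits m - {(m, 0)}. (case x of (a, b) \<Rightarrow> mfps_coeff R a * mfps_coeff Z b) = 0"
    proof
      fix x
      assume "x \<in> splits m - {(m, 0)}"
      then obtain a b where x: "x = (a, b)" and m: "m = a + b" and "b \<noteq> 0"
        by (cases x) (auto simp: splits_def)
      then have "mdegree b \<noteq> 0" by simp
      then have "mdegree a < mdegree m" unfolding m mdegree_add by linarith
      then show "(case x of (a, b) \<Rightarrow> mfps_coeff R a * mfps_coeff Z b) = 0" using assms x by simp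
    qed
  qed (simp add: splits_def)
  then show ?thesis by (simp add: mfps_coeff_mult)
qed

text \<open>The derivation \<open>\<Sum>i. z_i d/dz_i\<close>; in characteristic 0 only constants
  are killed, so one operator replaces all partial derivatives.\<close>

definition euler :: "('a :: comm_ring_1, 'd::finite) mfps \<Rightarrow> ('a, 'd) mfps" where
  "euler F = Abs_mfps (\<lambda>m. of_nat (mdegree m) * mfps_coeff F m)"

lemma mfps_coeff_euler [simp]: "mfps_coeff (euler F) m = of_nat (mdegree m) * mfps_coeff F m"
  by (simp add: euler_def)

lemma euler_add: "euler (F + G) = euler F + euler G"
  by (rule mfps_eqI) (simp add: algebra_simps)

lemma euler_mult: "euler (F * G) = euler F * G + F * euler G"
proof (rule mfps_eqI)
  fix m
  have "mfps_coeff (euler (F * G)) m =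
      (\<Sum>(a, b)\<in>splits m. of_nat (mdegree m) * (mfps_coeff F a * mfps_coeff G b))"
    by (simp add: mfps_coeff_mult sum_distrib_left case_prod_unfold)
  also have "\<dots> = (\<Sum>(a, b)\<in>splits m. mfps_coeff (euler F) a * mfps_coeff G b +
      mfps_coeff F a * mfps_coeff (euler G) b)"
    by (intro sum.cong) (auto simp: splits_def algebra_simps)
  also have "\<dots> = mfps_coeff (euler F * G + F * euler G) m"
    by (simp add: mfps_coeff_mult sum.distrib case_prod_unfold)
  finally show "mfps_coeff (euler (F * G)) m = mfps_coeff (euler F * G + F * euler G) m" .
qed

lemma euler_1: "euler 1 = 0"
  by (rule mfps_eqI) (simp add: mfps_coeff_1)

lemma euler_power_Suc: "euler (F ^ Suc n) = of_nat (Suc n) * (euler F * F ^ n)"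
proof (induction n)
  case (Suc n)
  then show ?case
    unfolding power_Suc[of F "Suc n"] euler_mult by (simp add: algebra_simps)
qed (simp add: euler_1)

text \<open>The chain rule holds term by term. The cutoff in \<open>mfps_exp\<close> depends on the
  exponent, but \<open>euler F\<close> has no constant term, so the other factor has degree at most
  \<open>d\<close>, and summing up to \<open>d\<close> loses nothing.\<close>

lemma euler_mfps_exp:
  assumes "mfps_coeff F 0 = 0"
  shows "euler (mfps_exp F) = euler F * mfps_exp F"
proof (rule mfps_eqI)
  fix m
  show "mfps_coeff (euler (mfps_exp F)) m = mfps_coeff (euler F * mfps_exp F) m"
  proof (cases "mdegree m")
    case 0
    then have "m = 0" by simp
    then show ?thesis by (simp add: mfps_coeff_mult_0)
  next
    case (Suc d)
    have "mfps_coeff (euler (mfps_exp F)) m =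
        (\<Sum>n\<le>Suc d. mfps_coeff (euler (F ^ n)) m / fact n)"
      by (simp only: mfps_coeff_euler mfps_exp_def mfps_coeff_Abs Suc sum_distrib_left times_divide_eq_right)
    also have "\<dots> = (\<Sum>n\<le>d. mfps_coeff (euler (F ^ Suc n)) m / fact (Suc n))"
      unfolding sum.atMost_Suc_shift by (simp add: euler_1 del: power_Suc mfps_coeff_euler fact_Suc)
    also have "\<dots> = (\<Sum>n\<le>d. mfps_coeff (euler F * F ^ n) m / fact n)"
    proof (rule sum.cong[OF refl])
      fix n
      have "of_nat (Suc n) \<noteq> (0 :: 'a)" by (rule of_nat_neq_0)
      then show "mfps_coeff (euler (F ^ Suc n)) m / fact (Suc n) = mfps_coeff (euler F * F ^ n) m / fact n"
        unfolding euler_power_Suc mfps_coeff_of_nat_mult fact_Suc by (simp del: of_nat_Suc)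
    qed
    also have "\<dots> = (\<Sum>(a, b)\<in>splits m. mfps_coeff (euler F) a * (\<Sum>n\<le>d. mfps_coeff (F ^ n) b / fact n))"
      unfolding mfps_coeff_mult sum_distrib_left sum_divide_distrib case_prod_unfold
      by (subst sum.swap) simp
    also have "\<dots> = (\<Sum>(a, b)\<in>splits m. mfps_coeff (euler F) a * mfps_coeff (mfps_exp F) b)"
    proof (rule sum.cong[OF refl], clarify)
      fix a b
      assume ab: "(a, b) \<in> splits m"
      show "mfps_coeff (euler F) a * (\<Sum>n\<le>d. mfps_coeff (F ^ n) b / fact n) =
          mfps_coeff (euler F) a * mfps_coeff (mfps_exp F) b"
      proof (cases "a = 0")
        case False
        then have "mdegree a \<noteq> 0" by simp
        moreover have "mdegree a + mdegree b = Suc d" using ab Suc by (auto simp: splits_def)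
        ultimately have "mdegree b \<le> d" by linarith
        then have "(\<Sum>n\<le>d. mfps_coeff (F ^ n) b / fact n) = mfps_coeff (mfps_exp F) b"
          unfolding mfps_exp_def mfps_coeff_Abs
          by (intro sum.mono_neutral_right) (auto simp: mfps_coeff_power_eq_0[OF assms])
        then show ?thesis by simp
      qed simp
    qed
    also have "\<dots> = mfps_coeff (euler F * mfps_exp F) m"
      by (simp only: mfps_coeff_mult)
    finally show ?thesis .
  qed
qed

lemma mfps_exp_0_coeff: "mfps_coeff (mfps_exp F) 0 = 1"
  by (simp add: mfps_exp_def mfps_coeff_1)

text \<open>As \<open>H\<close> has no constant term, the equation expresses
  \<open>mdegree m\<close> times the coefficient at \<open>m\<close> by coefficients of lower
  degree.\<close>

lemma euler_unique:
  fixes X Y H :: "('a :: field_char_0, 'd::finite) mfps"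
  assumes "euler X = H * X" "euler Y = H * Y" "mfps_coeff H 0 = 0" "mfps_coeff X 0 = mfps_coeff Y 0"
  shows "X = Y"
proof (rule mfps_eqI)
  fix m
  show "mfps_coeff X m = mfps_coeff Y m"
  proof (induction "mdegree m" arbitrary: m rule: less_induct)
    case less
    show ?case
    proof (cases "m = 0")
      case False
      have "mfps_coeff (H * X) m = mfps_coeff (H * Y) m"
        unfolding mfps_coeff_mult
      proof (rule sum.cong[OF refl], clarify)
        fix a b
        assume ab: "(a, b) \<in> splits m"
        show "mfps_coeff H a * mfps_coeff X b = mfps_coeff H a * mfps_coeff Y b"
        proof (cases "a = 0")
          case False
          then have "mdegree a \<noteq> 0" by simp
          moreover have "mdegree a + mdegree b = mdegree m" using ab by (auto simp: splits_def)
          ultimately have "mdegree b < mdegree m" by linarith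
          then show ?thesis using less by simp
        qed (simp add: assms)
      qed
      then have "of_nat (mdegree m) * mfps_coeff X m = of_nat (mdegree m) * mfps_coeff Y m"
        using assms(1,2) by (metis mfps_coeff_euler)
      then show ?thesis using False by simp
    qed (simp add: assms)
  qed
qed

section \<open>The lemma of Dieudonne and Dwork\<close>

definition mfps_monom :: "'a :: comm_ring_1 \<Rightarrow> nat ^ 'd \<Rightarrow> ('a, 'd::finite) mfps" where
  "mfps_monom c b = Abs_mfps (\<lambda>m. if m = b then c else 0)"

lemma mfps_monom_mult: "mfps_monom c a * mfps_monom d b = mfps_monom (c * d) (a + b)"
proof (rule mfps_eqI)
  fix m
  have "mfps_coeff (mfps_monom c a * mfps_monom d b) m =
      (\<Sum>x\<in>splits m. if x = (a, b) then c * d else 0)"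
    unfolding mfps_coeff_mult by (intro sum.cong) (auto simp: mfps_monom_def split: if_splits)
  also have "\<dots> = mfps_coeff (mfps_monom (c * d) (a + b)) m"
    by (subst sum.delta[OF finite_splits]) (auto simp: mfps_monom_def splits_def)
  finally show "mfps_coeff (mfps_monom c a * mfps_monom d b) m =
    mfps_coeff (mfps_monom (c * d) (a + b)) m" .
qed

lemma mfps_monom_power: "mfps_monom c b ^ n = mfps_monom (c ^ n) (n *s b)"
proof (induction n)
  case 0
  have "(0 :: nat) *s b = 0" by (simp add: vec_eq_iff)
  then show ?case by (auto intro!: mfps_eqI simp: mfps_monom_def mfps_coeff_1)
next
  case (Suc n)
  have "Suc n *s b = b + n *s b" by (simp add: vec_eq_iff)
  then show ?case by (simp add: Suc mfps_monom_mult)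
qed

context prime_localization
begin

text \<open>The substitution \<open>z \<mapsto> z\<^sup>p\<close>.\<close>

definition frob :: "('a :: comm_ring_1, 'd::finite) mfps \<Rightarrow> ('a, 'd) mfps" where
  "frob F = Abs_mfps (\<lambda>m. if \<forall>i. p dvd m $ i then mfps_coeff F (\<chi> i. m $ i div p) else 0)"

lemma vec_digit_decomposition:
  obtains a K where "m = a + p *s K" "digits a"
proof (rule that)
  show "m = (\<chi> i. m $ i mod p) + p *s (\<chi> i. m $ i div p)" by (simp add: vec_eq_iff)
  show "digits (\<chi> i. m $ i mod p)" using prime_gt_0_nat[OF prime_p] by (simp add: digits_def)
qed

lemma mfps_coeff_frob:
  assumes "digits a"
  shows "mfps_coeff (frob F) (a + p *s K) = (if a = 0 then mfps_coeff F K else 0)"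
proof -
  have p0: "p > 0" using prime_gt_0_nat[OF prime_p] .
  have "(\<forall>i. p dvd (a + p *s K) $ i) \<longleftrightarrow> a = 0"
  proof -
    have "p dvd (a + p *s K) $ i \<longleftrightarrow> a $ i = 0" for i
      using assms by (simp add: digits_def dvd_eq_mod_eq_0)
    then show ?thesis by (simp add: vec_eq_iff)
  qed
  moreover have "(\<chi> i. (p *s K) $ i div p) = K" using p0 by (simp add: vec_eq_iff)
  ultimately show ?thesis by (simp add: frob_def)
qed

lemma digits_0 [simp]: "digits 0"
  using prime_gt_0_nat[OF prime_p] by (simp add: digits_def)

lemma mfps_coeff_frob_smult: "mfps_coeff (frob F) (p *s K) = mfps_coeff F K"
  using mfps_coeff_frob[OF digits_0, of F K] by simp

lemma mfps_coeff_frob_0 [simp]: "mfps_coeff (frob F) 0 = mfps_coeff F 0"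
  by (simp add: frob_def flip: zero_vec_def)

lemma smult_inject_vec: "p *s a = p *s b \<longleftrightarrow> a = (b :: nat ^ 'd)"
  using prime_gt_0_nat[OF prime_p] by (simp add: vec_eq_iff)

text \<open>Only exponents \<open>p *s j\<close> occur in \<open>frob Y\<close>, and since the
  digits of \<open>a\<close> are below \<open>p\<close>, such an exponent fits below
  \<open>a + p *s K\<close> exactly when \<open>j \<le> K\<close>.\<close>

lemma mfps_coeff_mult_frob:
  assumes "digits a"
  shows "mfps_coeff (X * frob Y) (a + p *s K) =
    (\<Sum>j | j \<le> K. mfps_coeff X (a + p *s (K - j)) * mfps_coeff Y j)"
proof -
  have p0: "p > 0" using prime_gt_0_nat[OF prime_p] .
  let ?m = "a + p *s K"
  have le: "p *s j \<le> ?m \<longleftrightarrow> j \<le> K" for j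
  proof -
    have "p * x \<le> a $ i + p * y \<longleftrightarrow> x \<le> y" for x y i
    proof
      assume "p * x \<le> a $ i + p * y"
      also have "\<dots> < p * Suc y" using assms by (simp add: digits_def)
      finally show "x \<le> y" by (simp del: mult_Suc_right)
    qed (simp add: trans_le_add2)
    then show ?thesis by (simp add: less_eq_vec_def)
  qed
  have "mfps_coeff (X * frob Y) ?m =
      (\<Sum>j | j \<le> ?m. mfps_coeff X (?m - j) * mfps_coeff (frob Y) j)"
    by (rule mfps_coeff_mult_diff)
  also have "\<dots> = (\<Sum>j\<in>(\<lambda>j. p *s j) ` {j. j \<le> K}. mfps_coeff X (?m - j) * mfps_coeff (frob Y) j)"
  proof (rule sum.mono_neutral_right[OF finite_le_nat_vec])
    show "(\<lambda>j. p *s j) ` {j. j \<le> K} \<subseteq> {j. j \<le> ?m}" using le by auto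
    show "\<forall>j\<in>{j. j \<le> ?m} - (\<lambda>j. p *s j) ` {j. j \<le> K}. mfps_coeff X (?m - j) * mfps_coeff (frob Y) j = 0"
    proof
      fix j
      assume j: "j \<in> {j. j \<le> ?m} - (\<lambda>j. p *s j) ` {j. j \<le> K}"
      obtain b J where bJ: "j = b + p *s J" "digits b" by (rule vec_digit_decomposition)
      have "b \<noteq> 0" using j le bJ by auto
      then show "mfps_coeff X (?m - j) * mfps_coeff (frob Y) j = 0"
        using bJ by (simp add: mfps_coeff_frob)
    qed
  qed
  also have "\<dots> = (\<Sum>j | j \<le> K. mfps_coeff X (?m - p *s j) * mfps_coeff Y j)"
    by (subst sum.reindex) (auto simp: inj_on_def smult_inject_vec mfps_coeff_frob_smult)
  also have "\<dots> = (\<Sum>j | j \<le> K. mfps_coeff X (a + p *s (K - j)) * mfps_coeff Y j)"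
  proof (rule sum.cong[OF refl])
    fix j
    assume "j \<in> {j. j \<le> K}"
    then have "?m - p *s j = a + p *s (K - j)"
      by (simp add: vec_eq_iff less_eq_vec_def diff_mult_distrib2)
    then show "mfps_coeff X (?m - p *s j) * mfps_coeff Y j =
      mfps_coeff X (a + p *s (K - j)) * mfps_coeff Y j" by simp
  qed
  finally show ?thesis .
qed

lemma frob_mult:
  fixes F G :: "('a :: comm_ring_1, 'd::finite) mfps"
  shows "frob (F * G) = frob F * frob G"
proof (rule mfps_eqI)
  fix m :: "nat ^ 'd"
  obtain a K where m: "m = a + p *s K" and a: "digits a" by (rule vec_digit_decomposition)
  show "mfps_coeff (frob (F * G)) m = mfps_coeff (frob F * frob G) m"
    unfolding m mfps_coeff_mult_frob[OF a]
    by (simp add: mfps_coeff_frob[OF a] mfps_coeff_mult_diff)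
qed

lemma frob_add: "frob (F + G) = frob F + frob G"
  by (rule mfps_eqI) (simp add: frob_def)

lemma frob_monom: "frob (mfps_monom c b) = mfps_monom c (p *s b)" for b :: "nat ^ 'd"
proof (rule mfps_eqI)
  fix m :: "nat ^ 'd"
  obtain a K where m: "m = a + p *s K" and a: "digits a" by (rule vec_digit_decomposition)
  have "a + p *s K = p *s b \<longleftrightarrow> a = 0 \<and> K = b"
  proof
    assume *: "a + p *s K = p *s b"
    have "a $ i = 0" for i
    proof -
      have "a $ i + p * K $ i = p * b $ i" using * by (simp add: vec_eq_iff)
      then have "(a $ i + p * K $ i) mod p = (p * b $ i) mod p" by simp
      then show ?thesis using a by (simp add: digits_def)
    qed
    then have "a = 0" by (simp add: vec_eq_iff)
    with * show "a = 0 \<and> K = b" by (simp add: smult_inject_vec)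
  qed simp
  then show "mfps_coeff (frob (mfps_monom c b)) m = mfps_coeff (mfps_monom c (p *s b)) m"
    unfolding m mfps_coeff_frob[OF a] by (auto simp: mfps_monom_def)
qed

lemma euler_frob:
  fixes F :: "('a :: comm_ring_1, 'd::finite) mfps"
  shows "euler (frob F) = of_nat p * frob (euler F)"
proof (rule mfps_eqI)
  fix m :: "nat ^ 'd"
  obtain a K where m: "m = a + p *s K" and a: "digits a" by (rule vec_digit_decomposition)
  have "mdegree (p *s K) = p * mdegree K"
    by (simp add: mdegree_def sum_distrib_left)
  then show "mfps_coeff (euler (frob F)) m = mfps_coeff (of_nat p * frob (euler F)) m"
    unfolding m by (simp add: mfps_coeff_frob[OF a])
qed

section \<open>Congruences between power series\<close>

definition pseries :: "rat \<Rightarrow> (rat, 'd::finite) mfps set" where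
  "pseries c = {F. \<forall>m. mfps_coeff F m \<in> pideal p c}"

lemma pseriesD: "F \<in> pseries c \<Longrightarrow> mfps_coeff F m \<in> pideal p c"
  by (simp add: pseries_def)

lemma pseries_0 [simp]: "0 \<in> pseries c"
  by (simp add: pseries_def)

lemma pseries_1 [simp]: "1 \<in> pseries 1"
  by (simp add: pseries_def mfps_coeff_1)

lemma pseries_add: "F \<in> pseries c \<Longrightarrow> G \<in> pseries c \<Longrightarrow> F + G \<in> pseries c"
  by (auto simp: pseries_def)

lemma pseries_diff: "F \<in> pseries c \<Longrightarrow> G \<in> pseries c \<Longrightarrow> F - G \<in> pseries c"
  by (auto simp: pseries_def)

lemma pseries_mult: "F \<in> pseries c \<Longrightarrow> G \<in> pseries d \<Longrightarrow> F * G \<in> pseries (c * d)"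
  by (auto simp: pseries_def mfps_coeff_mult intro!: pideal_sum pideal_mult)

lemma pseries_power: "F \<in> pseries c \<Longrightarrow> F ^ n \<in> pseries (c ^ n)"
  by (induction n) (auto intro: pseries_mult)

lemma pseries_sum: "(\<And>i. i \<in> A \<Longrightarrow> F i \<in> pseries c) \<Longrightarrow> sum F A \<in> pseries c"
  by (induction A rule: infinite_finite_induct) (auto intro: pseries_add)

lemma pseries_frob:
  assumes "F \<in> pseries c"
  shows "frob F \<in> pseries c"
  using assms by (auto simp: pseries_def frob_def)

lemma freshmans_dream_pseries:
  assumes "X \<in> pseries 1" "Y \<in> pseries 1"
  shows "(X + Y) ^ p - (X ^ p + Y ^ p) \<in> pseries (of_nat p)"
proof -
  have p0: "p > 0" using prime_gt_0_nat[OF prime_p] .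
  have "{..p} = insert 0 (insert p {0<..<p})" using p0 by auto
  then have "(X + Y) ^ p - (X ^ p + Y ^ p) = (\<Sum>k\<in>{0<..<p}. of_nat (p choose k) * X ^ k * Y ^ (p - k))"
    using p0 by (simp add: binomial_ring)
  also have "\<dots> \<in> pseries (of_nat p)"
  proof (rule pseries_sum)
    fix k
    assume "k \<in> {0<..<p}"
    then have "p dvd (p choose k)" using prime_p by (intro dvd_choose_prime) auto
    then obtain c where c: "p choose k = p * c" ..
    have XY: "X ^ k * Y ^ (p - k) \<in> pseries 1"
      using pseries_mult[OF pseries_power[OF assms(1)] pseries_power[OF assms(2)], of k "p - k"] by simp
    have "mfps_coeff (of_nat (p choose k) * X ^ k * Y ^ (p - k)) m =
        of_nat p * (of_nat c * mfps_coeff (X ^ k * Y ^ (p - k)) m)" for m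
      unfolding c by (simp add: mult.assoc)
    moreover have "of_nat p * (of_nat c * mfps_coeff (X ^ k * Y ^ (p - k)) m) \<in> pideal p (of_nat p)" for m
      using pseriesD[OF XY] by (intro pidealI pint_mult) auto
    ultimately show "of_nat (p choose k) * X ^ k * Y ^ (p - k) \<in> pseries (of_nat p)"
      by (simp add: pseries_def)
  qed
  finally show ?thesis .
qed

text \<open>Monomials are removed from the support one at a time: a single monomial is Fermat's
  theorem for its coefficient, and the sum is handled by the binomial theorem modulo
  \<open>p\<close>.\<close>

lemma frob_power_cong:
  assumes "finite B" "Q \<in> pseries 1" "\<And>m. m \<notin> B \<Longrightarrow> mfps_coeff Q m = 0"
  shows "frob Q - Q ^ p \<in> pseries (of_nat p)"
  using assms
proof (induction B arbitrary: Q rule: finite_induct)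
  case empty
  then have "Q = 0" by (auto intro: mfps_eqI)
  then show ?case using prime_gt_0_nat[OF prime_p] by (simp add: pseries_def frob_def power_0_left)
next
  case (insert b B)
  define c where "c = mfps_coeff Q b"
  define P where "P = Abs_mfps (\<lambda>m. if m = b then 0 else mfps_coeff Q m)"
  define M where "M = mfps_monom c b"
  have c: "c \<in> pint p" using pseriesD[OF insert.prems(1), of b] by (simp add: c_def)
  have Q: "Q = P + M" by (rule mfps_eqI) (simp add: P_def M_def mfps_monom_def c_def)
  have P: "P \<in> pseries 1" using pseriesD[OF insert.prems(1)] by (simp add: pseries_def P_def)
  have M: "M \<in> pseries 1" using c by (simp add: pseries_def M_def mfps_monom_def)
  have 1: "frob P - P ^ p \<in> pseries (of_nat p)"
    using insert.prems(2) by (intro insert.IH P) (auto simp: P_def)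
  have 2: "frob M - M ^ p \<in> pseries (of_nat p)"
  proof -
    have "c - c ^ p \<in> pideal p (of_nat p)" using pideal_uminus[OF fermat_pint[OF c]] by simp
    then show ?thesis
      unfolding M_def frob_monom mfps_monom_power by (simp add: pseries_def mfps_monom_def)
  qed
  have "frob Q - Q ^ p = (frob P - P ^ p) + (frob M - M ^ p) - ((P + M) ^ p - (P ^ p + M ^ p))"
    unfolding Q frob_add by (simp add: algebra_simps)
  also have "\<dots> \<in> pseries (of_nat p)"
    by (rule pseries_diff[OF pseries_add[OF 1 2] freshmans_dream_pseries[OF P M]])
  finally show ?case .
qed

lemma pint_inverse_pfree_fact: "inverse (of_nat (pfree_fact n)) \<in> pint p"
  by (intro pint_inverse_of_nat not_dvd_pfree_fact)

text \<open>With \<open>k = n div p\<close>, \<open>fact n\<close> is a unit times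
  \<open>p ^ k * fact k\<close>. Because \<open>2 * k \<le> n\<close> for every prime, including 2,
  a factor \<open>p ^ k / fact k\<close> can be split off and the induction continues; for
  \<open>k = 0\<close> the factorial is itself a unit.\<close>

lemma prime_power_div_fact:
  assumes "n \<ge> 1"
  shows "of_nat p ^ n / fact n \<in> pideal p (of_nat p)"
  using assms
proof (induction n rule: less_induct)
  case (less n)
  define k where "k = n div p"
  have "fact n = pfree_fact n * p ^ k * fact k"
    unfolding k_def by (rule fact_eq_pfree_fact)
  then have f: "(fact n :: rat) = of_nat (pfree_fact n) * of_nat p ^ k * fact k"
    by (metis of_nat_fact of_nat_mult of_nat_power)
  have "p * k \<le> n" by (simp add: k_def)
  then have kn: "2 * k \<le> n"
    using mult_le_mono1[OF prime_ge_2_nat[OF prime_p], of k] by linarith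
  show ?case
  proof (cases "k = 0")
    case True
    have "of_nat p ^ n / fact n = of_nat p * (of_nat p ^ (n - 1) * inverse (of_nat (pfree_fact n)) :: rat)"
      unfolding f using True less.prems by (simp add: field_simps flip: power_Suc)
    also have "\<dots> \<in> pideal p (of_nat p)"
      by (intro pidealI pint_mult pint_power pint_of_nat pint_inverse_pfree_fact)
    finally show ?thesis .
  next
    case False
    have "of_nat p ^ n = (of_nat p ^ (n - 2 * k) * of_nat p ^ k * of_nat p ^ k :: rat)"
      using kn by (simp flip: power_add mult_2)
    then have "of_nat p ^ n / fact n =
        of_nat p ^ (n - 2 * k) * inverse (of_nat (pfree_fact n)) * (of_nat p ^ k / fact k :: rat)"
      unfolding f using of_nat_p_neq_0 by (simp add: field_simps)
    also have "\<dots> \<in> pideal p (of_nat p)"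
      using False kn less.prems
      by (intro pideal_mult_left less.IH pint_mult pint_power pint_of_nat pint_inverse_pfree_fact) auto
    finally show ?thesis .
  qed
qed

lemma mfps_exp_pseries:
  assumes "g \<in> pseries (of_nat p)"
  shows "mfps_exp g - 1 \<in> pseries (of_nat p)"
proof -
  have "mfps_coeff (mfps_exp g - 1) m \<in> pideal p (of_nat p)" for m
  proof -
    have "{..mdegree m} = insert 0 {1..mdegree m}" by auto
    then have "mfps_coeff (mfps_exp g - 1) m = (\<Sum>n=1..mdegree m. mfps_coeff (g ^ n) m / fact n)"
      by (simp add: mfps_exp_def)
    also have "\<dots> \<in> pideal p (of_nat p)"
    proof (rule pideal_sum)
      fix n
      assume "n \<in> {1..mdegree m}"
      then have n: "n \<ge> 1" by simp
      obtain y where y: "mfps_coeff (g ^ n) m = of_nat p ^ n * y" "y \<in> pint p"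
        using pseriesD[OF pseries_power[OF assms], of n m] by (auto simp: pideal_def)
      then show "mfps_coeff (g ^ n) m / fact n \<in> pideal p (of_nat p)"
        using pideal_mult_right[OF prime_power_div_fact[OF n] y(2)] by simp
    qed
    finally show ?thesis .
  qed
  then show ?thesis by (simp add: pseries_def del: mfps_coeff_diff)
qed

text \<open>Both sides solve \<open>\<theta> y = \<theta> (f(z\<^sup>p)) y\<close> for the Euler operator \<open>\<theta>\<close>.\<close>

lemma frob_mfps_exp:
  fixes f :: "('a :: field_char_0, 'd::finite) mfps"
  assumes "mfps_coeff f 0 = 0"
  shows "frob (mfps_exp f) = mfps_exp f ^ p * mfps_exp (frob f - of_nat p * f)"
proof -
  define q where "q = mfps_exp f"
  define g where "g = frob f - of_nat p * f"
  have g0: "mfps_coeff g 0 = 0" using assms by (simp add: g_def)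
  have q: "euler q = euler f * q" unfolding q_def by (rule euler_mfps_exp[OF assms])
  have e: "euler (mfps_exp g) = euler g * mfps_exp g" by (rule euler_mfps_exp[OF g0])
  have ff: "frob f = of_nat p * f + g" by (simp add: g_def)
  have eof: "euler (of_nat p * f) = of_nat p * euler f"
    by (rule mfps_eqI) (simp add: mult.left_commute)
  obtain n where n: "p = Suc n" using prime_gt_0_nat[OF prime_p] gr0_implies_Suc by blast
  show ?thesis
    unfolding q_def[symmetric] g_def[symmetric]
  proof (rule euler_unique)
    show "euler (frob q) = euler (frob f) * frob q"
      unfolding euler_frob q frob_mult by (simp add: mult_ac)
    have "euler (q ^ p) = of_nat p * euler f * q ^ p"
      unfolding n euler_power_Suc q by (simp add: mult_ac)
    then show "euler (q ^ p * mfps_exp g) = euler (frob f) * (q ^ p * mfps_exp g)"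
      unfolding euler_mult[of "q ^ p"] e ff euler_add eof by (simp add: algebra_simps)
    show "mfps_coeff (euler (frob f)) 0 = 0" by simp
    show "mfps_coeff (frob q) 0 = mfps_coeff (q ^ p * mfps_exp g) 0"
      by (simp add: q_def mfps_exp_0_coeff mfps_coeff_mult_0 mfps_coeff_power_0)
  qed
qed

text \<open>The start is \<open>q(z^p) = q^p e\<close> with \<open>e\<close> congruent to 1 modulo
  \<open>p\<close>. Let \<open>Q\<close> be \<open>q\<close> truncated below the degree of
  \<open>m\<close>, integral by induction. At \<open>m\<close>, \<open>q^p\<close> differs from
  \<open>Q^p\<close> by \<open>p\<close> times the unknown coefficient, while \<open>q(z^p)\<close>
  agrees with \<open>Q(z^p)\<close>, which is congruent to \<open>Q^p\<close>. So \<open>p\<close>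
  times the coefficient is divisible by \<open>p\<close>.\<close>

theorem dieudonne_dwork:
  assumes f0: "mfps_coeff f 0 = 0" and f: "frob f - of_nat p * f \<in> pseries (of_nat p)"
  shows "mfps_exp f \<in> pseries 1"
proof -
  define q where "q = mfps_exp f"
  define e where "e = mfps_exp (frob f - of_nat p * f)"
  have e1: "e - 1 \<in> pseries (of_nat p)" unfolding e_def by (rule mfps_exp_pseries[OF f])
  have e0: "mfps_coeff (e - 1) 0 = 0" by (simp add: e_def mfps_exp_0_coeff mfps_coeff_1)
  have q0: "mfps_coeff q 0 = 1" by (simp add: q_def mfps_exp_0_coeff)
  have qe: "frob q = q ^ p * e" unfolding q_def e_def by (rule frob_mfps_exp[OF f0])
  have "mfps_coeff q m \<in> pint p" for m
  proof (induction "mdegree m" arbitrary: m rule: less_induct)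
    case less
    show ?case
    proof (cases "m = 0")
      case True
      then show ?thesis by (simp add: q0)
    next
      case False
      define Q where "Q = Abs_mfps (\<lambda>b. if mdegree b < mdegree m then mfps_coeff q b else 0)"
      \<comment> \<open>The cofactor in \<open>q ^ p - Q ^ p = (q - Q) * Z\<close>. Since
        \<open>q - Q\<close> has no terms of degree below \<open>mdegree m\<close>, only the
        constant term \<open>p\<close> of \<open>Z\<close> matters at \<open>m\<close>.\<close>
      define Z where "Z = (\<Sum>i<p. Q ^ (p - Suc i) * q ^ i)"
      have dm: "mdegree m > 0" using False mdegree_eq_0_iff[of m] by linarith
      have R: "mfps_coeff (q - Q) b = 0" if "mdegree b < mdegree m" for b
        using that by (simp add: Q_def)
      have Rm: "mfps_coeff (q - Q) m = mfps_coeff q m" by (simp add: Q_def)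
      have Q0: "mfps_coeff Q 0 = 1" using dm by (simp add: Q_def q0)
      have Q1: "Q \<in> pseries 1" using less by (simp add: pseries_def Q_def)
      have Qp: "Q ^ p \<in> pseries 1" using pseries_power[OF Q1, of p] by simp
      have Z0: "mfps_coeff Z 0 = of_nat p"
        by (simp add: Z_def mfps_coeff_sum mfps_coeff_mult_0 mfps_coeff_power_0 Q0 q0)
      have diff: "q ^ p - Q ^ p = (q - Q) * Z"
        unfolding Z_def by (rule power_diff_sumr2)
      have low: "mfps_coeff ((q - Q) * X) m = mfps_coeff q m * mfps_coeff X 0" for X
        using mfps_coeff_mult_lowest[of m "q - Q" X] R Rm by metis
      have "q ^ p = Q ^ p + (q - Q) * Z" using diff by (simp add: algebra_simps)
      then have "frob q = (Q ^ p + (q - Q) * Z) * e" unfolding qe by simp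
      \<comment> \<open>The last product contributes nothing at \<open>m\<close>, because
        \<open>e - 1\<close> has zero constant term.\<close>
      also have "\<dots> = Q ^ p + (q - Q) * Z + Q ^ p * (e - 1) + (q - Q) * (Z * (e - 1))"
        by (simp add: algebra_simps)
      finally have "frob q = \<dots>" .
      then have "mfps_coeff (frob q) m = mfps_coeff (Q ^ p) m + mfps_coeff q m * of_nat p +
          mfps_coeff (Q ^ p * (e - 1)) m"
        by (simp only: mfps_coeff_add low Z0 mfps_coeff_mult_0 e0 mult_zero_right add_0_right)
      moreover have "mfps_coeff (frob q) m = mfps_coeff (frob Q) m"
      proof -
        obtain a K where m: "m = a + p *s K" and a: "digits a" by (rule vec_digit_decomposition)
        have "mfps_coeff q K = mfps_coeff Q K" if "a = 0"
        proof -
          have "mdegree m = p * mdegree K" using that m by (simp add: mdegree_def sum_distrib_left)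
          then have "mdegree K < mdegree m"
            using dm prime_gt_1_nat[OF prime_p] by simp
          then show ?thesis by (simp add: Q_def)
        qed
        then show ?thesis unfolding m by (simp add: mfps_coeff_frob[OF a])
      qed
      moreover have "mfps_coeff (frob Q - Q ^ p) m \<in> pideal p (of_nat p)"
      proof (rule pseriesD, rule frob_power_cong)
        \<comment> \<open>The box serves as a finite set containing the support of
          \<open>Q\<close>.\<close>
        have "b \<in> box (mdegree m)" if "mdegree b < mdegree m" for b :: "nat ^ 'a"
        proof -
          have "b \<in> box (0 + mdegree b)" by (rule le_imp_in_box) simp
          also have "box (0 + mdegree b) \<subseteq> (box (mdegree m) :: (nat ^ 'a) set)"
            using that by (intro box_mono) simp
          finally show ?thesis .
        qed
        then show "mfps_coeff Q b = 0" if "b \<notin> box (mdegree m)" for b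
          using that by (auto simp: Q_def)
      qed (use Q1 in auto)
      moreover have "mfps_coeff (Q ^ p * (e - 1)) m \<in> pideal p (of_nat p)"
        using pseriesD[OF pseries_mult[OF Qp e1]] by simp
      moreover have "of_nat p * mfps_coeff q m =
          mfps_coeff (frob Q - Q ^ p) m - mfps_coeff (Q ^ p * (e - 1)) m"
        using calculation(1,2) by simp
      ultimately have "of_nat p * mfps_coeff q m \<in> pideal p (of_nat p)"
        by (simp only: pideal_diff)
      then show ?thesis using of_nat_p_neq_0 by (auto simp: pideal_def)
    qed
  qed
  then show ?thesis by (simp add: pseries_def q_def)
qed

text \<open>The constant term 1 of \<open>X\<close> lets the coefficients of \<open>Y\<close> be
  solved for recursively by degree.\<close>

lemma pseries_cancel:
  assumes "X \<in> pseries 1" "mfps_coeff X 0 = 1" "X * Y \<in> pseries c"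
  shows "Y \<in> pseries c"
proof -
  have "mfps_coeff Y m \<in> pideal p c" for m
  proof (induction "mdegree m" arbitrary: m rule: less_induct)
    case less
    have "(0, m) \<in> splits m" by (simp add: splits_def)
    then have "mfps_coeff (X * Y) m =
        mfps_coeff Y m + (\<Sum>(a, b)\<in>splits m - {(0, m)}. mfps_coeff X a * mfps_coeff Y b)"
      using assms(2) by (simp add: mfps_coeff_mult sum.remove)
    moreover have "(\<Sum>(a, b)\<in>splits m - {(0, m)}. mfps_coeff X a * mfps_coeff Y b) \<in> pideal p c"
    proof (rule pideal_sum)
      fix x
      assume "x \<in> splits m - {(0, m)}"
      then obtain a b where x: "x = (a, b)" and m: "m = a + b" and "a \<noteq> 0"
        by (cases x) (auto simp: splits_def)
      then have "mdegree a \<noteq> 0" by simp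
      then have "mdegree b < mdegree m" unfolding m mdegree_add by linarith
      then show "(case x of (a, b) \<Rightarrow> mfps_coeff X a * mfps_coeff Y b) \<in> pideal p c"
        using pseriesD[OF assms(1), of a] less x by (auto intro: pideal_mult_left)
    qed
    moreover have "mfps_coeff (X * Y) m \<in> pideal p c" by (rule pseriesD[OF assms(3)])
    ultimately show ?case using pideal_diff by fastforce
  qed
  then show ?thesis by (simp add: pseries_def)
qed

end

context dwork_log
begin

text \<open>Multiplication by \<open>F * frob F\<close>, a \<open>p\<close>-integral series with
  constant term 1, clears the denominators in \<open>frob f - p * f\<close> and can be cancelled
  afterwards. The cleared coefficients are the sums of \<open>sum_A_h_pideal\<close>.\<close>

theorem mfps_exp_quotient_pseries:
  fixes F G :: "(rat, 'd) mfps"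
  assumes F: "\<And>m. mfps_coeff F m = A m" and G: "\<And>m. mfps_coeff G m = h m * A m"
  shows "mfps_exp (G / F) \<in> pseries 1"
proof -
  define f where "f = G / F"
  have F0: "mfps_coeff F 0 = 1" by (simp add: F A_0)
  have Ff: "F * f = G"
    using mfps_mult_inverse[of F] F0 unfolding f_def divide_mfps_def
    by (simp add: mult.left_commute[of F G])
  have "mfps_coeff (F * frob G - of_nat p * (G * frob F)) m \<in> pideal p (of_nat p)" for m
  proof -
    obtain a K where m: "m = a + p *s K" and a: "digits a" by (rule vec_digit_decomposition)
    have "mfps_coeff (F * frob G - of_nat p * (G * frob F)) m =
        (\<Sum>j | j \<le> K. A (a + p *s (K - j)) * A j * (h j - of_nat p * h (a + p *s (K - j))))"
      unfolding m mfps_coeff_diff mfps_coeff_of_nat_mult mfps_coeff_mult_frob[OF a] F G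
      by (simp add: sum_distrib_left algebra_simps flip: sum_subtractf)
    also have "\<dots> \<in> pideal p (of_nat p)" by (rule sum_A_h_pideal[OF a])
    finally show ?thesis .
  qed
  then have "F * frob G - of_nat p * (G * frob F) \<in> pseries (of_nat p)"
    unfolding pseries_def by blast
  also have "F * frob G - of_nat p * (G * frob F) = (F * frob F) * (frob f - of_nat p * f)"
    unfolding Ff[symmetric] frob_mult by (simp add: algebra_simps)
  finally have "(F * frob F) * (frob f - of_nat p * f) \<in> pseries (of_nat p)" .
  moreover have F1: "F \<in> pseries 1" by (simp add: pseries_def F A_pint)
  have "F * frob F \<in> pseries 1"
    using pseries_mult[OF F1 pseries_frob[OF F1]] by simp
  moreover have "mfps_coeff (F * frob F) 0 = 1"
    by (simp add: mfps_coeff_mult_0 F0)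
  ultimately have "frob f - of_nat p * f \<in> pseries (of_nat p)"
    by (blast intro: pseries_cancel)
  moreover have "mfps_coeff f 0 = 0"
    using arg_cong[OF Ff, of "\<lambda>X. mfps_coeff X 0"] by (simp add: mfps_coeff_mult_0 F0 G h_0)
  ultimately show ?thesis unfolding f_def by (rule dieudonne_dwork[rotated])
qed

end

section \<open>Integrality of the mirror map\<close>

definition nat_vec :: "int ^ 'd \<Rightarrow> nat ^ 'd" where
  "nat_vec v = (\<chi> i. nat (v $ i))"

lemma nat_pairing:
  assumes "0 \<le> v"
  shows "nat (pairing v m) = dotn (nat_vec v) m"
proof -
  have "pairing v m = int (dotn (nat_vec v) m)"
    using assms by (simp add: pairing_def dotn_def nat_vec_def less_eq_vec_def)
  then show ?thesis by simp
qed

lemma FG_coeff_eq_prod_multinom: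
  assumes "\<And>j. j \<in> {1..k} \<Longrightarrow> 0 \<le> N j"
  shows "FG_coeff k N m = (\<Prod>j=1..k. multinom (nat_vec (N j)) m)"
  unfolding FG_coeff_def
proof (rule prod.cong[OF refl])
  fix j
  assume "j \<in> {1..k}"
  then have N: "0 \<le> N j" by (rule assms)
  have "(fact (m $ i) :: rat) powi (N j $ i) = fact (m $ i) ^ (nat_vec (N j) $ i)" for i
    using N by (simp add: nat_vec_def less_eq_vec_def power_int_def)
  then show "fact (nat (pairing (N j) m)) / (\<Prod>i\<in>UNIV. fact (m $ i) powi (N j $ i)) =
      multinom (nat_vec (N j)) m"
    by (simp add: multinom_def nat_pairing[OF N])
qed

text \<open>Congruences for the ratios pass from each multinomial to the product. The harmonic
  condition needs just the divisor \<open>multinom l m\<close> of the factor \<open>j = 1\<close>,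
  available because \<open>n 1 = l + l'\<close>.\<close>

lemma dwork_log_prod_multinom:
  fixes n :: "nat \<Rightarrow> nat ^ 'd" and l l' :: "nat ^ 'd"
  assumes "prime p" "k \<ge> 1" "n 1 = l + l'"
  shows "dwork_log p (\<lambda>m. \<Prod>j=1..k. multinom (n j) m) (\<lambda>m. harmonic (dotn l m))"
proof -
  interpret prime_localization p by unfold_locales fact
  define A where "A = (\<lambda>m. \<Prod>j=1..k. multinom (n j) m)"
  have A_ratio: "A (v + p *s w) / A w = (\<Prod>j=1..k. ratio (n j) v w)" for v w
    by (simp add: A_def ratio_def prod_dividef)
  have A_factor: "\<exists>c\<in>pint p. A m = c * multinom l m" for m
  proof
    let ?c = "multinom l' m * of_nat (dotn l m + dotn l' m choose dotn l m) *
      (\<Prod>j\<in>{1..k} - {1}. multinom (n j) m)"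
    show "?c \<in> pint p"
      by (intro pint_mult pint_prod pint_of_nat pint_Ints[OF multinom_Ints])
    have "A m = multinom (n 1) m * (\<Prod>j\<in>{1..k} - {1}. multinom (n j) m)"
      unfolding A_def using assms(2) by (intro prod.remove) auto
    then show "A m = ?c * multinom l m" unfolding assms(3) multinom_add by (simp only: mult_ac)
  qed
  have "dwork_log p A (\<lambda>m. harmonic (dotn l m))"
  proof
    fix m v w n' :: "nat ^ 'd" and s :: nat
    show "A m \<noteq> 0" "A 0 = 1" by (simp_all add: A_def)
    show "A m \<in> pint p" unfolding A_def by (intro pint_prod pint_Ints multinom_Ints)
    show "harmonic (dotn l 0) = 0" by (simp add: harmonic_def)
    show "of_nat p * harmonic (dotn l (p *s w)) - harmonic (dotn l w) \<in> pideal p (of_nat p)"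
      unfolding dotn_smult_right by (rule harmonic_mult_p)
    assume v: "digits v"
    show "A (v + p *s w) / A w \<in> pint p"
      unfolding A_ratio by (intro pint_prod ratio_pint v)
    show "A (v + p *s (w + p ^ s *s n')) / A (w + p ^ s *s n') - A (v + p *s w) / A w
        \<in> pideal p (of_nat p ^ Suc s)"
      unfolding A_ratio by (intro pideal_prod_cong ratio_cong ratio_pint v)
    obtain c where c: "c \<in> pint p" "A (v + p *s w) = c * multinom l (v + p *s w)"
      using A_factor by blast
    show "A (v + p *s w) * of_nat p ^ s *
        (harmonic (dotn l (p ^ s *s (v + p *s w))) - harmonic (dotn l (p ^ Suc s *s w))) \<in> pint p"
      using pint_mult[OF c(1) multinom_harmonic_pint[OF v, of l w s]]
      unfolding c(2) dotn_smult_right by (simp only: mult.assoc)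
  qed
  then show ?thesis unfolding A_def .
qed

theorem theorem2:
  fixes k :: nat and L :: "int ^ 'd" and N :: "nat \<Rightarrow> int ^ 'd"
  assumes "k \<ge> 1"
    and "0 \<le> L" and "L \<le> N 1"
    and "\<forall>j\<in>{2..k}. 0 \<le> N j"
  shows "q_series k L N \<in> mfps_Ints"
proof -
  define n where "n j = nat_vec (N j)" for j
  define l where "l = nat_vec L"
  have "0 \<le> N j" if "j \<in> {1..k}" for j
  proof (cases "j = 1")
    case True
    then show ?thesis using assms(2,3) by simp
  qed (use that assms(4) in auto)
  then have A: "FG_coeff k N m = (\<Prod>j=1..k. multinom (n j) m)" for m
    unfolding n_def by (rule FG_coeff_eq_prod_multinom)
  \<comment> \<open>The subtraction of natural vectors is not truncated here, because
    \<open>L \<le> N 1\<close>.\<close>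
  have n1: "n 1 = l + (n 1 - l)"
    using assms(3) by (simp add: n_def l_def nat_vec_def vec_eq_iff less_eq_vec_def nat_mono)
  have "mfps_coeff (q_series k L N) m \<in> pint p" if "prime p" for p m
  proof -
    interpret dwork_log p "\<lambda>m. \<Prod>j=1..k. multinom (n j) m" "\<lambda>m. harmonic (dotn l m)"
      by (rule dwork_log_prod_multinom[of p k n l "n 1 - l", OF that assms(1) n1])
    have "q_series k L N \<in> pseries 1"
      unfolding q_series_def
      by (rule mfps_exp_quotient_pseries)
        (simp_all add: F_series_def G_series_def A nat_pairing[OF assms(2)] l_def)
    from pseriesD[OF this] show ?thesis by simp
  qed
  then show ?thesis
    by (auto simp: mfps_Ints_def intro: Ints_if_all_pint)
qed

end
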